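(* Assume the setting and all standing assumptions listed in the context (two-time-scale recursion with constant step sizes, regularity of $f,g,\lambda$, noise variances bounded by quadratic functions of the state). Let $$B_1=L_f^2+4L_\lambda^2L_g^2+2L_fL_\lambda L_g+\frac1cL_g^2(L_\lambda+2)+4cL_\lambda^2L_g^2(L_\lambda+1)^2+L_g^2(2L_\lambda^2+L_\lambda+3),\qquad B_2=\frac{2}{\mu_g}L_f^2L_\lambda^2L_g^2(L_\lambda+1)^2,$$ and for $\omega>0$ let $$D_1(\omega)=-\frac12\mu_g+c\frac{2}{\mu_f}L_\lambda^2\frac{1}{\omega^2}\Big(\Gamma_{21}\frac1c\omega+\Gamma_{22}\Big),$$ $$D_2(\omega)=B_1\omega^2+2c\,\omega\Big(\Gamma_{11}\frac1c\omega+\Gamma_{12}\Big)+\Big(2cL_\lambda^2\frac1\omega+1\Big)\Big(\Gamma_{21}\frac1c\omega+\Gamma_{22}\Big),$$ $$D_3(\omega)=B_2\omega^2+c\frac{2}{\mu_f}L_f^2L_\lambda^2\Big(\Gamma_{21}\frac1c\omega+\Gamma_{22}\Big).$$ Suppose $$\omega\ge\max\left\{\frac{4}{\mu_f}\Big(2L_\lambda L_g+\frac{2}{\mu_g}L_\lambda^2L_g^2(L_\lambda+1)^2\Big),\ 2c,\ \frac{\mu_g}{\mu_f},\ 1\right\}\qquad\text{and}\qquad D_1(\omega)\le-\frac14\mu_g.$$ Then there exist $\beta>0$ and $\epsilon>0$ such that $$e^{-\epsilon}=1+D_1(\omega)\beta+D_2(\omega)\beta^2+D_3(\omega)\beta^3<1,$$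 and for such $\beta,\epsilon$, the process with constant step sizes $\beta_k=\beta$, $\alpha_k=\alpha=\omega\beta$ satisfies, for all integers $k\ge0$, $$\mathbb{E}[V_k]\le e^{-\epsilon k}V_0.$$
   Context: Norms and inner products are Euclidean. Let $f:\mathbb{R}^{d_1}\times\mathbb{R}^{d_2}\to\mathbb{R}^{d_1}$ and $g:\mathbb{R}^{d_1}\times\mathbb{R}^{d_2}\to\mathbb{R}^{d_2}$. Standing assumptions: (i) There is a unique $(x^*,y^* )$ with $f(x^*,y^* )=0$ and $g(x^*,y^* )=0$. (ii) There is a map $\lambda:\mathbb{R}^{d_2}\to\mathbb{R}^{d_1}$ such that, for each $y$, $x=\lambda(y)$ is the unique solution of $f(x,y)=0$, and $\|\lambda(y_1)-\lambda(y_2)\|\le L_\lambda\|y_1-y_2\|$ for all $y_1,y_2$. (iii) $\|f(x_1,y_1)-f(x_2,y_2)\|\le L_f(\|x_1-x_2\|+\|y_1-y_2\|)$ for all arguments, and for some $\mu_f>0$, $\langle x_1-x_2,f(x_1,y)-f(x_2,y)\rangle\ge\mu_f\|x_1-x_2\|^2$ for all $x_1,x_2,y$. (iv) $\|g(x_1,y_1)-g(x_2,y_2)\|\le L_g(\|x_1-x_2\|+\|y_1-y_2\|)$ for all arguments, and for some $\mu_g>0$, $\langle y-y^*,g(\lambda(y),y)\rangle\ge\mu_g\|y-y^*\|^2$ for all $y$. The process starts from deterministic $x_0,y_0$ and is $$x_{k+1}=x_k-\alpha_k[f(x_k,y_k)+\xi_k],\qquad y_{k+1}=y_k-\beta_k[g(x_k,y_k)+\psi_k],\qquad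 k\ge0,$$ with constant step sizes $\alpha_k=\alpha>0$, $\beta_k=\beta>0$ and random noises $\xi_k\in\mathbb{R}^{d_1}$, $\psi_k\in\mathbb{R}^{d_2}$. Let $\hat x_k=x_k-\lambda(y_k)$, $\hat y_k=y_k-y^*$, and let $\mathcal{Q}_k$ be the $\sigma$-algebra generated by $x_0,y_0,\xi_0,\psi_0,\dots,\xi_k,\psi_k$ ($\mathcal{Q}_{-1}$ is generated by $x_0,y_0$). (v) Noise: $\mathbb{E}[\xi_k\mid\mathcal{Q}_{k-1}]=0$, $\mathbb{E}[\psi_k\mid\mathcal{Q}_{k-1}]=0$, and there are constants $\Gamma_{ij}\ge0$, $i,j\in\{1,2\}$ (not depending on the step sizes), such that almost surely for all $k\ge0$ $$\mathbb{E}[\|\xi_k\|^2\mid\mathcal{Q}_{k-1}]\le\Gamma_{11}\|\hat x_k\|^2+\Gamma_{12}\|\hat y_k\|^2,\qquad \mathbb{E}[\|\psi_k\|^2\mid\mathcal{Q}_{k-1}]\le\Gamma_{21}\|\hat x_k\|^2+\Gamma_{22}\|\hat y_k\|^2.$$ No assumption is made on the correlation between $\xi_k$ and $\psi_k$. Let $c=\dfrac{4L_g^2}{\mu_f\mu_g}$ and define the Lyapunov function $V_k=c\,\dfrac{\beta}{\alpha}\|\hat x_k\|^2+\|\hat y_k\|^2$. *)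

theory Defs
  imports "HOL-Probability.Probability"
begin

text \<open>
  \<open>noise_history M x0 y0 \<xi> \<psi> k\<close> is the \<open>\<sigma>\<close>-algebra \<open>Q\<^bsub>k-1\<^esub>\<close> generated by the initial
  point and the noises with index \<open>j < k\<close>; in particular \<open>k = 0\<close> gives \<open>Q\<^bsub>-1\<^esub>\<close>.
\<close>

definition noise_history ::
  "'w measure \<Rightarrow> ('w \<Rightarrow> real ^ 'd1) \<Rightarrow> ('w \<Rightarrow> real ^ 'd2) \<Rightarrow>
   (nat \<Rightarrow> 'w \<Rightarrow> real ^ 'd1) \<Rightarrow> (nat \<Rightarrow> 'w \<Rightarrow> real ^ 'd2) \<Rightarrow> nat \<Rightarrow> 'w measure" where
  "noise_history M x0 y0 \<xi> \<psi> k = sigma (space M)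
     ({x0 -` A \<inter> space M | A. A \<in> sets borel} \<union>
      {y0 -` B \<inter> space M | B. B \<in> sets borel} \<union>
      {\<xi> j -` A \<inter> space M | j A. j < k \<and> A \<in> sets borel} \<union>
      {\<psi> j -` B \<inter> space M | j B. j < k \<and> B \<in> sets borel})"

text \<open>
  The conditional mean of a vector is taken coordinatewise. The conditional second moments use
  the \<open>ennreal\<close>-valued conditional expectation, which is meaningful without integrability; as the
  initial point is deterministic, the bounds on them make all noises square integrable, so that
  the \<open>real_cond_exp\<close> terms are genuine conditional expectations as well.
\<close>

locale two_time_scale_process = prob_space M
  for M :: "'w measure" +
  fixes f :: "real ^ 'd1 \<Rightarrow> real ^ 'd2 \<Rightarrow> real ^ 'd1"
    and g :: "real ^ 'd1 \<Rightarrow> real ^ 'd2 \<Rightarrow> real ^ 'd2"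
    and lam :: "real ^ 'd2 \<Rightarrow> real ^ 'd1"
    and ystar :: "real ^ 'd2"
    and \<Gamma>11 \<Gamma>12 \<Gamma>21 \<Gamma>22 :: real
    and \<alpha> \<beta> :: real
    and x0 :: "real ^ 'd1" and y0 :: "real ^ 'd2"
    and \<xi> :: "nat \<Rightarrow> 'w \<Rightarrow> real ^ 'd1" and \<psi> :: "nat \<Rightarrow> 'w \<Rightarrow> real ^ 'd2"
    and x :: "nat \<Rightarrow> 'w \<Rightarrow> real ^ 'd1" and y :: "nat \<Rightarrow> 'w \<Rightarrow> real ^ 'd2"
  assumes noise_measurable:
      "\<And>k. \<xi> k \<in> borel_measurable M" "\<And>k. \<psi> k \<in> borel_measurable M"
    and init: "\<And>w. w \<in> space M \<Longrightarrow> x 0 w = x0" "\<And>w. w \<in> space M \<Longrightarrow> y 0 w = y0"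
    and x_step: "\<And>k w. w \<in> space M \<Longrightarrow>
      x (Suc k) w = x k w - \<alpha> *\<^sub>R (f (x k w) (y k w) + \<xi> k w)"
    and y_step: "\<And>k w. w \<in> space M \<Longrightarrow>
      y (Suc k) w = y k w - \<beta> *\<^sub>R (g (x k w) (y k w) + \<psi> k w)"
    and xi_mean: "\<And>k i. AE w in M.
      real_cond_exp M (noise_history M (x 0) (y 0) \<xi> \<psi> k) (\<lambda>w. \<xi> k w $ i) w = 0"
    and psi_mean: "\<And>k i. AE w in M.
      real_cond_exp M (noise_history M (x 0) (y 0) \<xi> \<psi> k) (\<lambda>w. \<psi> k w $ i) w = 0"
    and xi_second_moment: "\<And>k. AE w in M.
      nn_cond_exp M (noise_history M (x 0) (y 0) \<xi> \<psi> k) (\<lambda>w. ennreal ((norm (\<xi> k w))\<^sup>2)) w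
      \<le> ennreal (\<Gamma>11 * (norm (x k w - lam (y k w)))\<^sup>2 + \<Gamma>12 * (norm (y k w - ystar))\<^sup>2)"
    and psi_second_moment: "\<And>k. AE w in M.
      nn_cond_exp M (noise_history M (x 0) (y 0) \<xi> \<psi> k) (\<lambda>w. ennreal ((norm (\<psi> k w))\<^sup>2)) w
      \<le> ennreal (\<Gamma>21 * (norm (x k w - lam (y k w)))\<^sup>2 + \<Gamma>22 * (norm (y k w - ystar))\<^sup>2)"

definition lyapunov ::
  "(real ^ 'd2 \<Rightarrow> real ^ 'd1) \<Rightarrow> real ^ 'd2 \<Rightarrow> real \<Rightarrow> real \<Rightarrow> real \<Rightarrow>
   real ^ 'd1 \<Rightarrow> real ^ 'd2 \<Rightarrow> real" where
  "lyapunov lam ystar c \<alpha> \<beta> x y =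
     c * (\<beta> / \<alpha>) * (norm (x - lam y))\<^sup>2 + (norm (y - ystar))\<^sup>2"

end

theory Submission
  imports Defs
begin

text \<open>
  The fast iterate chases the moving target \<open>lam y\<close> and the slow iterate descends along the curve
  \<open>x = lam y\<close>. Each of the errors \<open>x - lam y\<close> and \<open>y - ystar\<close> contracts up to an error caused by
  the other, and a weighted sum of their squares contracts if the weight balances the two coupling
  errors: this is the Lyapunov function, with weight \<open>c * \<beta> / \<alpha> = c / \<omega>\<close>.

  The estimate is first made pathwise (\<open>lyapunov_step\<close>, combining \<open>fast_step\<close> and \<open>slow_step\<close>):
  the new value is at most a factor \<open>drift \<beta>\<close> times the old one, plus multiples of the squared
  noises, plus inner products of the noises with functions of the current state. The only noise
  that cannot be kept linear is the slow noise moving the target, since \<open>lam\<close> is merely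
  Lipschitz; it is absorbed at the price of a part of the fast contraction.

  Taking expectations (\<open>lyapunov_expectation_step\<close>), the inner products vanish because the state
  is measurable with respect to the history and the noise is conditionally centred, and the squared
  noises are bounded by the Lyapunov function itself, because their variances are quadratic in the
  state. Hence the expectation is multiplied by at most one fixed factor per step, which is
  precisely the cubic \<open>1 + D1 \<omega> * \<beta> + D2 \<omega> * \<beta>^2 + D3 \<omega> * \<beta>^3\<close>. As \<open>D1 \<omega> < 0\<close>, small \<open>\<beta>\<close> make
  it less than one.
\<close>

section \<open>Pathwise estimates for the two equations\<close>

text \<open>
  Every cross term below is split by this inequality. The free weight \<open>t\<close> is what allows the
  square of the contracting variable to be charged to its own contraction rate.
\<close>
lemma two_mult_le_weighted_squares:
  fixes a b t :: real
  assumes "t > 0"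
  shows "2 * a * b \<le> t * a\<^sup>2 + b\<^sup>2 / t"
proof -
  have "0 \<le> (t * a - b)\<^sup>2 / t" using assms by simp
  also have "\<dots> = t * a\<^sup>2 + b\<^sup>2 / t - 2 * a * b"
    using assms by (simp add: power2_eq_square field_simps)
  finally show ?thesis by simp
qed

locale coupled_maps =
  fixes f :: "real ^ 'd1 \<Rightarrow> real ^ 'd2 \<Rightarrow> real ^ 'd1"
    and g :: "real ^ 'd1 \<Rightarrow> real ^ 'd2 \<Rightarrow> real ^ 'd2"
    and lam :: "real ^ 'd2 \<Rightarrow> real ^ 'd1" and ystar :: "real ^ 'd2"
    and Lf Lg L \<mu> \<nu> :: real
  assumes f_lam: "f (lam v) v = 0"
    and g_star: "g (lam ystar) ystar = 0"
    and lam_lip: "norm (lam v1 - lam v2) \<le> L * norm (v1 - v2)"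
    and f_lip: "norm (f u1 v1 - f u2 v2) \<le> Lf * (norm (u1 - u2) + norm (v1 - v2))"
    and g_lip: "norm (g u1 v1 - g u2 v2) \<le> Lg * (norm (u1 - u2) + norm (v1 - v2))"
    and f_mono: "(u1 - u2) \<bullet> (f u1 v - f u2 v) \<ge> \<mu> * (norm (u1 - u2))\<^sup>2"
    and g_mono: "(v - ystar) \<bullet> g (lam v) v \<ge> \<nu> * (norm (v - ystar))\<^sup>2"
    and mu_pos: "\<mu> > 0" and nu_pos: "\<nu> > 0"
begin

text \<open>
  The hypotheses are tested at a unit vector, which exists because the index types are nonempty;
  there a Lipschitz bound on \<open>f\<close> or \<open>g\<close> must dominate the monotonicity modulus. In particular \<open>Lg > 0\<close> keeps the weight of the Lyapunov function away from \<open>0\<close>.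
\<close>
lemma constants_pos: "L \<ge> 0" "Lf > 0" "Lg > 0"
proof -
  let ?u = "axis undefined 1 :: real ^ 'd1" and ?v = "axis undefined 1 :: real ^ 'd2"
  show L: "L \<ge> 0"
    using lam_lip[of ?v 0] norm_ge_zero[of "lam ?v - lam 0"] by (simp del: norm_ge_zero)
  have "\<mu> \<le> (?u - 0) \<bullet> (f ?u 0 - f 0 0)" using f_mono[of ?u 0 0] by simp
  also have "\<dots> \<le> norm (?u - 0) * norm (f ?u 0 - f 0 0)" by (rule norm_cauchy_schwarz)
  also have "\<dots> \<le> Lf" using f_lip[of ?u 0 0 0] by simp
  finally show "Lf > 0" using mu_pos by simp
  let ?w = "ystar + ?v"
  have "\<nu> \<le> (?w - ystar) \<bullet> g (lam ?w) ?w" using g_mono[of ?w] by simp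
  also have "\<dots> \<le> norm (?w - ystar) * norm (g (lam ?w) ?w)" by (rule norm_cauchy_schwarz)
  also have "\<dots> \<le> Lg * (norm (lam ?w - lam ystar) + 1)"
    using g_lip[of "lam ?w" ?w "lam ystar" ystar] g_star by simp
  finally have "0 < Lg * (norm (lam ?w - lam ystar) + 1)" using nu_pos by simp
  thus "Lg > 0" by (simp add: zero_less_mult_iff add_nonneg_pos)
      (smt (verit) norm_ge_zero)
qed

lemma norm_f_le: "norm (f u v) \<le> Lf * norm (u - lam v)"
  using f_lip[of u v "lam v" v] by (simp add: f_lam)

lemma norm_g_diff_le: "norm (g u v - g (lam v) v) \<le> Lg * norm (u - lam v)"
  using g_lip[of u v "lam v" v] by simp

lemma norm_g_le: "norm (g u v) \<le> Lg * norm (u - lam v) + Lg * (L + 1) * norm (v - ystar)"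
proof -
  have "norm (g (lam v) v) \<le> Lg * (norm (lam v - lam ystar) + norm (v - ystar))"
    using g_lip[of "lam v" v "lam ystar" ystar] by (simp add: g_star)
  also have "\<dots> \<le> Lg * (L * norm (v - ystar) + norm (v - ystar))"
    using lam_lip[of v ystar] constants_pos by (intro mult_left_mono) auto
  finally have "norm (g (lam v) v) \<le> Lg * (L + 1) * norm (v - ystar)" by (simp add: algebra_simps)
  moreover have "norm (g u v) \<le> norm (g u v - g (lam v) v) + norm (g (lam v) v)"
    using norm_triangle_ineq[of "g u v - g (lam v) v" "g (lam v) v"] by simp
  ultimately show ?thesis using norm_g_diff_le[of u v] by linarith
qed

text \<open>
  The same quantity is needed with two distributions of the cross term: the fast equation sees
  \<open>g\<close> through \<open>lam\<close> and uses the symmetric split, while the slow equation uses the sharper split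
  that matches the last summand of the quadratic rate, via \<open>(L - 1)\<^sup>2 \<ge> 0\<close>.
\<close>
lemma norm_g_square_le:
  defines "X u v \<equiv> norm (u - lam v)" and "Y v \<equiv> norm (v - ystar)"
  shows "(norm (g u v))\<^sup>2 \<le> 2 * Lg\<^sup>2 * (X u v)\<^sup>2 + 2 * Lg\<^sup>2 * (L + 1)\<^sup>2 * (Y v)\<^sup>2"
    and "(norm (g u v))\<^sup>2 \<le> Lg\<^sup>2 * (L + 2) * (X u v)\<^sup>2 + Lg\<^sup>2 * (2 * L\<^sup>2 + L + 3) * (Y v)\<^sup>2"
proof -
  let ?X = "X u v" and ?Y = "Y v"
  have "(norm (g u v))\<^sup>2 \<le> (Lg * ?X + Lg * (L + 1) * ?Y)\<^sup>2"
    using norm_g_le[of u v] unfolding X_def Y_def by (intro power_mono) auto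
  hence *: "(norm (g u v))\<^sup>2 \<le> Lg\<^sup>2 * (?X\<^sup>2 + (L + 1) * (2 * ?X * ?Y) + (L + 1)\<^sup>2 * ?Y\<^sup>2)"
    by (simp add: power2_eq_square algebra_simps)
  have "(L + 1) * (2 * ?X * ?Y) \<le> ?X\<^sup>2 + (L + 1)\<^sup>2 * ?Y\<^sup>2"
    using zero_le_power2[of "?X - (L + 1) * ?Y"] by (simp add: power2_eq_square algebra_simps)
  hence "Lg\<^sup>2 * (?X\<^sup>2 + (L + 1) * (2 * ?X * ?Y) + (L + 1)\<^sup>2 * ?Y\<^sup>2)
      \<le> Lg\<^sup>2 * (2 * ?X\<^sup>2 + 2 * (L + 1)\<^sup>2 * ?Y\<^sup>2)"
    by (intro mult_left_mono) (linarith | simp)+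
  with * show "(norm (g u v))\<^sup>2 \<le> 2 * Lg\<^sup>2 * ?X\<^sup>2 + 2 * Lg\<^sup>2 * (L + 1)\<^sup>2 * ?Y\<^sup>2"
    by (simp add: algebra_simps)
  have "(L + 1) * (2 * ?X * ?Y) \<le> (L + 1) * (?X\<^sup>2 + ?Y\<^sup>2)"
    using constants_pos sum_squares_bound[of ?X ?Y] by (intro mult_left_mono) auto
  moreover have "((L + 1) + (L + 1)\<^sup>2) * ?Y\<^sup>2 \<le> (2 * L\<^sup>2 + L + 3) * ?Y\<^sup>2"
    using zero_le_power2[of "L - 1"]
    by (intro mult_right_mono) (auto simp: power2_eq_square algebra_simps)
  ultimately have "?X\<^sup>2 + (L + 1) * (2 * ?X * ?Y) + (L + 1)\<^sup>2 * ?Y\<^sup>2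
      \<le> (L + 2) * ?X\<^sup>2 + (2 * L\<^sup>2 + L + 3) * ?Y\<^sup>2"
    by (simp add: algebra_simps)
  hence "Lg\<^sup>2 * (?X\<^sup>2 + (L + 1) * (2 * ?X * ?Y) + (L + 1)\<^sup>2 * ?Y\<^sup>2)
      \<le> Lg\<^sup>2 * ((L + 2) * ?X\<^sup>2 + (2 * L\<^sup>2 + L + 3) * ?Y\<^sup>2)"
    by (intro mult_left_mono) auto
  with * show "(norm (g u v))\<^sup>2 \<le> Lg\<^sup>2 * (L + 2) * ?X\<^sup>2 + Lg\<^sup>2 * (2 * L\<^sup>2 + L + 3) * ?Y\<^sup>2"
    by (simp add: algebra_simps)
qed

text \<open>
  The slow error contracts because \<open>g\<close> points away from the root along the curve \<open>u = lam v\<close>;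
  half of that contraction pays for the distance \<open>u - lam v\<close> to the curve. The noise enters through
  its square and through a linear term that will have mean zero.
\<close>
lemma slow_step:
  assumes b: "\<beta> > 0"
  defines "v' u v s \<equiv> v - \<beta> *\<^sub>R (g u v + s)"
  shows "(norm (v' u v s - ystar))\<^sup>2 \<le>
      (\<beta> * (Lg\<^sup>2 / \<nu>) + \<beta>\<^sup>2 * (Lg\<^sup>2 * (L + 2))) * (norm (u - lam v))\<^sup>2
      + (1 - \<beta> * \<nu> + \<beta>\<^sup>2 * (Lg\<^sup>2 * (2 * L\<^sup>2 + L + 3))) * (norm (v - ystar))\<^sup>2
      + \<beta>\<^sup>2 * (norm s)\<^sup>2 - 2 * \<beta> * ((v - ystar - \<beta> *\<^sub>R g u v) \<bullet> s)"
proof -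
  define h where "h = v - ystar"
  let ?X = "norm (u - lam v)"
  have "(norm (v' u v s - ystar))\<^sup>2 = (norm h)\<^sup>2 - 2 * \<beta> * (h \<bullet> g u v) + \<beta>\<^sup>2 * (norm (g u v))\<^sup>2
      + \<beta>\<^sup>2 * (norm s)\<^sup>2 - 2 * \<beta> * ((h - \<beta> *\<^sub>R g u v) \<bullet> s)"
    unfolding v'_def h_def power2_norm_eq_inner
    by (simp add: algebra_simps inner_commute power2_eq_square)
  moreover have "\<beta> * (- 2 * (h \<bullet> g u v)) \<le> \<beta> * (- \<nu> * (norm h)\<^sup>2 + Lg\<^sup>2 / \<nu> * ?X\<^sup>2)"
  proof (intro mult_left_mono)
    have "- (h \<bullet> (g u v - g (lam v) v)) \<le> norm h * norm (g u v - g (lam v) v)"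
      using Cauchy_Schwarz_ineq2[of h "g u v - g (lam v) v"] by linarith
    also have "\<dots> \<le> norm h * (Lg * ?X)" using norm_g_diff_le by (intro mult_left_mono) auto
    finally have "- (h \<bullet> g u v) \<le> - (h \<bullet> g (lam v) v) + norm h * (Lg * ?X)"
      by (simp add: inner_diff_right)
    moreover have "2 * norm h * (Lg * ?X) \<le> \<nu> * (norm h)\<^sup>2 + (Lg * ?X)\<^sup>2 / \<nu>"
      by (rule two_mult_le_weighted_squares[OF nu_pos])
    ultimately show "- 2 * (h \<bullet> g u v) \<le> - \<nu> * (norm h)\<^sup>2 + Lg\<^sup>2 / \<nu> * ?X\<^sup>2"
      using g_mono[of v] by (simp add: h_def power_mult_distrib)
  qed (use b in auto)
  moreover have "\<beta>\<^sup>2 * (norm (g u v))\<^sup>2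
     \<le> \<beta>\<^sup>2 * (Lg\<^sup>2 * (L + 2) * ?X\<^sup>2 + Lg\<^sup>2 * (2 * L\<^sup>2 + L + 3) * (norm h)\<^sup>2)"
    using norm_g_square_le(2)[of u v] unfolding h_def by (intro mult_left_mono) auto
  ultimately show ?thesis unfolding h_def[symmetric] by (simp add: algebra_simps)
qed

text \<open>
  The fast error contracts at rate \<open>2 * \<alpha> * \<mu>\<close>, but its target \<open>lam v\<close> moves by \<open>d\<close>, of
  norm at most \<open>L * \<beta> * norm (g u v + s)\<close>. Since \<open>lam\<close> is only Lipschitz, the slow noise inside
  \<open>d\<close> does not average out in the inner product with the contracted error; it is bounded by
  Cauchy-Schwarz and charged to \<open>\<alpha> * \<mu>\<close>, half of the contraction. The resulting
  \<open>\<beta>\<^sup>2 / \<alpha>\<close> in front of \<open>(norm s)\<^sup>2\<close> is first order in the step size and is the reason for the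
  noise term in the linear rate. In the bound on \<open>(norm d)\<^sup>2\<close>, by contrast, the product of \<open>s\<close> with
  \<open>g u v\<close> is kept as an inner product.
\<close>
lemma fast_step:
  assumes a: "\<alpha> > 0" and b: "\<beta> > 0"
  defines "u' u v r \<equiv> u - \<alpha> *\<^sub>R (f u v + r)" and "v' u v s \<equiv> v - \<beta> *\<^sub>R (g u v + s)"
    and "A \<equiv> L * Lg * (L + 1)"
  shows "(norm (u' u v r - lam (v' u v s)))\<^sup>2 \<le>
      (1 - \<alpha> * \<mu> + \<alpha>\<^sup>2 * Lf\<^sup>2 + 4 * L\<^sup>2 * Lg\<^sup>2 * \<beta>\<^sup>2
         + (2 * L * Lg + 2 / \<nu> * A\<^sup>2) * \<beta> + 2 * Lf * L * Lg * \<alpha> * \<beta>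
         + 2 / \<nu> * Lf\<^sup>2 * A\<^sup>2 * \<alpha>\<^sup>2 * \<beta>) * (norm (u - lam v))\<^sup>2
      + (\<nu> * \<beta> + 4 * L\<^sup>2 * Lg\<^sup>2 * (L + 1)\<^sup>2 * \<beta>\<^sup>2) * (norm (v - ystar))\<^sup>2
      + 2 * \<alpha>\<^sup>2 * (norm r)\<^sup>2
      + (2 / \<mu> * L\<^sup>2 * \<beta>\<^sup>2 / \<alpha> + 2 * L\<^sup>2 * \<beta>\<^sup>2 + 2 / \<mu> * Lf\<^sup>2 * L\<^sup>2 * \<beta>\<^sup>2 * \<alpha>) * (norm s)\<^sup>2
      - 2 * \<alpha> * ((u - lam v - \<alpha> *\<^sub>R f u v) \<bullet> r) + 4 * L\<^sup>2 * \<beta>\<^sup>2 * (g u v \<bullet> s)"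
proof -
  define h where "h = u - lam v"
  define d where "d = lam v - lam (v' u v s)"
  define p where "p = h - \<alpha> *\<^sub>R f u v"
  let ?X = "norm h" and ?Y = "norm (v - ystar)" and ?S = "norm s" and ?G = "norm (g u v)"
  note pos = constants_pos mu_pos nu_pos a b
  have "(norm (u' u v r - lam (v' u v s)))\<^sup>2 = (norm (p - \<alpha> *\<^sub>R r + d))\<^sup>2"
    by (simp add: u'_def p_def h_def d_def algebra_simps)
  also have "\<dots> = (norm p)\<^sup>2 + (norm (\<alpha> *\<^sub>R r))\<^sup>2 + (norm d)\<^sup>2 - 2 * \<alpha> * (p \<bullet> r) + 2 * (p \<bullet> d)
      - 2 * ((\<alpha> *\<^sub>R r) \<bullet> d)"
    unfolding power2_norm_eq_inner by (simp add: algebra_simps inner_commute)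
  \<comment> \<open>Nothing is known about the correlation of \<open>r\<close> with the noise in \<open>d\<close>, so their product
    is split into squares.\<close>
  also have "\<dots> \<le> (norm p)\<^sup>2 + 2 * \<alpha>\<^sup>2 * (norm r)\<^sup>2 + 2 * (norm d)\<^sup>2 - 2 * \<alpha> * (p \<bullet> r) + 2 * (p \<bullet> d)"
    using zero_le_power2[of "norm (\<alpha> *\<^sub>R r + d)"] power_mult_distrib[of \<alpha> "norm r" 2]
    unfolding power2_norm_eq_inner by (simp add: algebra_simps inner_commute power2_eq_square)
  finally have expand: "(norm (u' u v r - lam (v' u v s)))\<^sup>2 \<le> \<dots>" .
  have p2: "(norm p)\<^sup>2 \<le> (1 - 2 * \<alpha> * \<mu> + \<alpha>\<^sup>2 * Lf\<^sup>2) * ?X\<^sup>2"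
  proof -
    have "(norm p)\<^sup>2 = ?X\<^sup>2 - 2 * \<alpha> * (h \<bullet> f u v) + \<alpha>\<^sup>2 * (norm (f u v))\<^sup>2"
      unfolding p_def power2_norm_eq_inner by (simp add: algebra_simps inner_commute power2_eq_square)
    moreover have "\<alpha> * (\<mu> * ?X\<^sup>2) \<le> \<alpha> * (h \<bullet> f u v)"
      using f_mono[of u "lam v" v] a by (intro mult_left_mono) (auto simp: f_lam h_def)
    moreover have "\<alpha>\<^sup>2 * (norm (f u v))\<^sup>2 \<le> \<alpha>\<^sup>2 * (Lf * ?X)\<^sup>2"
      using norm_f_le[of u v] unfolding h_def by (intro mult_left_mono power_mono) auto
    ultimately show ?thesis by (simp add: algebra_simps power_mult_distrib)
  qed
  have d1: "norm d \<le> L * (\<beta> * norm (g u v + s))"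
    using lam_lip[of v "v' u v s"] b by (simp add: d_def v'_def)
  have d2: "(norm d)\<^sup>2 \<le> L\<^sup>2 * \<beta>\<^sup>2 * (?G\<^sup>2 + 2 * (g u v \<bullet> s) + ?S\<^sup>2)"
  proof -
    have "(norm d)\<^sup>2 \<le> (L * (\<beta> * norm (g u v + s)))\<^sup>2" using d1 by (intro power_mono) auto
    also have "\<dots> = L\<^sup>2 * \<beta>\<^sup>2 * (norm (g u v + s))\<^sup>2" by (simp add: power_mult_distrib)
    also have "(norm (g u v + s))\<^sup>2 = ?G\<^sup>2 + 2 * (g u v \<bullet> s) + ?S\<^sup>2"
      unfolding power2_norm_eq_inner by (simp add: algebra_simps inner_commute)
    finally show ?thesis .
  qed
  have G2: "L\<^sup>2 * \<beta>\<^sup>2 * ?G\<^sup>2 \<le> L\<^sup>2 * \<beta>\<^sup>2 * (2 * Lg\<^sup>2 * ?X\<^sup>2 + 2 * Lg\<^sup>2 * (L + 1)\<^sup>2 * ?Y\<^sup>2)"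
    using norm_g_square_le(1)[of u v] unfolding h_def by (intro mult_left_mono) auto
  have "2 * (p \<bullet> d) \<le> 2 * ((1 + \<alpha> * Lf) * ?X * (L * \<beta> * (Lg * ?X + Lg * (L + 1) * ?Y + ?S)))"
  proof -
    have "p \<bullet> d \<le> norm p * norm d" by (rule norm_cauchy_schwarz)
    also have "\<dots> \<le> ((1 + \<alpha> * Lf) * ?X) * (L * \<beta> * (Lg * ?X + Lg * (L + 1) * ?Y + ?S))"
    proof (intro mult_mono)
      have "norm p \<le> ?X + \<alpha> * norm (f u v)"
        unfolding p_def using norm_triangle_ineq4[of h "\<alpha> *\<^sub>R f u v"] a by simp
      also have "\<dots> \<le> ?X + \<alpha> * (Lf * ?X)"
        using norm_f_le[of u v] a unfolding h_def by (intro add_left_mono mult_left_mono) auto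
      finally show "norm p \<le> (1 + \<alpha> * Lf) * ?X" by (simp add: algebra_simps)
      have "norm (g u v + s) \<le> Lg * ?X + Lg * (L + 1) * ?Y + ?S"
        using norm_triangle_ineq[of "g u v" s] norm_g_le[of u v] unfolding h_def by linarith
      hence "L * \<beta> * norm (g u v + s) \<le> L * \<beta> * (Lg * ?X + Lg * (L + 1) * ?Y + ?S)"
        using pos by (intro mult_left_mono) auto
      with d1 show "norm d \<le> L * \<beta> * (Lg * ?X + Lg * (L + 1) * ?Y + ?S)" by (simp add: mult.assoc)
    qed (use pos in auto)
    finally show ?thesis by simp
  qed
  also have "\<dots> = 2 * L * Lg * \<beta> * ?X\<^sup>2 + 2 * Lf * L * Lg * \<alpha> * \<beta> * ?X\<^sup>2
      + \<beta> * (2 * ?Y * (A * ?X)) + \<beta> * (2 * ?Y * (\<alpha> * Lf * A * ?X))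
      + 2 * ?X * (L * \<beta> * ?S) + 2 * ?X * (\<alpha> * Lf * L * \<beta> * ?S)"
    by (simp add: A_def power2_eq_square algebra_simps)
  finally have cross: "2 * (p \<bullet> d) \<le> \<dots>" .
  have Y1: "\<beta> * (2 * ?Y * (A * ?X)) \<le> \<beta> * (\<nu> / 2 * ?Y\<^sup>2 + 2 / \<nu> * A\<^sup>2 * ?X\<^sup>2)"
    using two_mult_le_weighted_squares[of "\<nu> / 2" ?Y "A * ?X"] pos
    by (intro mult_left_mono) (auto simp: power_mult_distrib mult_ac)
  have Y2: "\<beta> * (2 * ?Y * (\<alpha> * Lf * A * ?X))
      \<le> \<beta> * (\<nu> / 2 * ?Y\<^sup>2 + 2 / \<nu> * \<alpha>\<^sup>2 * Lf\<^sup>2 * A\<^sup>2 * ?X\<^sup>2)"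
    using two_mult_le_weighted_squares[of "\<nu> / 2" ?Y "\<alpha> * Lf * A * ?X"] pos
    by (intro mult_left_mono) (auto simp: power_mult_distrib mult_ac)
  have S1: "2 * ?X * (L * \<beta> * ?S) \<le> \<alpha> * \<mu> / 2 * ?X\<^sup>2 + 2 / \<mu> * L\<^sup>2 * \<beta>\<^sup>2 / \<alpha> * ?S\<^sup>2"
    using two_mult_le_weighted_squares[of "\<alpha> * \<mu> / 2" ?X "L * \<beta> * ?S"] pos
    by (auto simp: power_mult_distrib mult_ac)
  have S2: "2 * ?X * (\<alpha> * Lf * L * \<beta> * ?S)
      \<le> \<alpha> * \<mu> / 2 * ?X\<^sup>2 + 2 / \<mu> * Lf\<^sup>2 * L\<^sup>2 * \<beta>\<^sup>2 * \<alpha> * ?S\<^sup>2"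
  proof -
    have "(\<alpha> * Lf * L * \<beta> * ?S)\<^sup>2 / (\<alpha> * \<mu> / 2) = 2 / \<mu> * Lf\<^sup>2 * L\<^sup>2 * \<beta>\<^sup>2 * \<alpha> * ?S\<^sup>2"
      using pos by (simp add: power2_eq_square field_simps)
    thus ?thesis
      using two_mult_le_weighted_squares[of "\<alpha> * \<mu> / 2" ?X "\<alpha> * Lf * L * \<beta> * ?S"] pos by simp
  qed
  show ?thesis
    using expand p2 d2 G2 cross Y1 Y2 S1 S2
    unfolding p_def h_def[symmetric] by (simp add: algebra_simps)
qed

lemma maps_continuous:
  "continuous_on UNIV (\<lambda>(u, v). f u v)" "continuous_on UNIV (\<lambda>(u, v). g u v)"
  "continuous_on UNIV lam"
proof -
  have sum_le: "norm (fst p - fst q) + norm (snd p - snd q) \<le> 2 * dist p q"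
    for p q :: "(real ^ 'd1) \<times> (real ^ 'd2)"
    using dist_fst_le[of p q] dist_snd_le[of p q] by (simp add: dist_norm)
  have "(2 * Lf)-lipschitz_on UNIV (\<lambda>(u, v). f u v)"
  proof (rule lipschitz_onI)
    fix p q :: "(real ^ 'd1) \<times> (real ^ 'd2)"
    have "Lf * (norm (fst p - fst q) + norm (snd p - snd q)) \<le> Lf * (2 * dist p q)"
      using constants_pos sum_le by (intro mult_left_mono) auto
    thus "dist (case p of (u, v) \<Rightarrow> f u v) (case q of (u, v) \<Rightarrow> f u v) \<le> 2 * Lf * dist p q"
      using f_lip[of "fst p" "snd p" "fst q" "snd q"] by (simp add: dist_norm case_prod_beta)
  qed (use constants_pos in simp)
  thus "continuous_on UNIV (\<lambda>(u, v). f u v)" by (rule lipschitz_on_continuous_on)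
  have "(2 * Lg)-lipschitz_on UNIV (\<lambda>(u, v). g u v)"
  proof (rule lipschitz_onI)
    fix p q :: "(real ^ 'd1) \<times> (real ^ 'd2)"
    have "Lg * (norm (fst p - fst q) + norm (snd p - snd q)) \<le> Lg * (2 * dist p q)"
      using constants_pos sum_le by (intro mult_left_mono) auto
    thus "dist (case p of (u, v) \<Rightarrow> g u v) (case q of (u, v) \<Rightarrow> g u v) \<le> 2 * Lg * dist p q"
      using g_lip[of "fst p" "snd p" "fst q" "snd q"] by (simp add: dist_norm case_prod_beta)
  qed (use constants_pos in simp)
  thus "continuous_on UNIV (\<lambda>(u, v). g u v)" by (rule lipschitz_on_continuous_on)
  have "L-lipschitz_on UNIV lam"
    using lam_lip constants_pos by (intro lipschitz_onI) (auto simp: dist_norm)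
  thus "continuous_on UNIV lam" by (rule lipschitz_on_continuous_on)
qed

end

section \<open>Pathwise Lyapunov estimate\<close>

text \<open>
  The four lower bounds on \<open>\<omega>\<close> have separate purposes: the first makes the drift of the target
  \<open>lam v\<close> small against the fast contraction, the second bounds by \<open>1 / 2\<close> the weight \<open>c / \<omega>\<close> of
  the fast error, the third makes the fast contraction at least as quick as the slow one, and the
  last lets powers of \<open>\<omega>\<close> be raised to \<open>\<omega>\<^sup>2\<close>. The value of \<open>c\<close> makes the coupling error of the slow
  equation exactly one quarter of the fast contraction.
\<close>
locale separated_time_scales = coupled_maps +
  fixes c \<omega> :: real
  assumes c_eq: "c = 4 * Lg\<^sup>2 / (\<mu> * \<nu>)"
    and omega_fast: "\<omega> \<ge> 4 / \<mu> * (2 * L * Lg + 2 / \<nu> * L\<^sup>2 * Lg\<^sup>2 * (L + 1)\<^sup>2)"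
    and omega_c: "\<omega> \<ge> 2 * c" and omega_ratio: "\<omega> \<ge> \<nu> / \<mu>" and omega_1: "\<omega> \<ge> 1"
begin

definition "rate_quadratic = Lf\<^sup>2 + 4 * L\<^sup>2 * Lg\<^sup>2 + 2 * Lf * L * Lg + 1 / c * Lg\<^sup>2 * (L + 2)
      + 4 * c * L\<^sup>2 * Lg\<^sup>2 * (L + 1)\<^sup>2 + Lg\<^sup>2 * (2 * L\<^sup>2 + L + 3)"

definition "rate_cubic = 2 / \<nu> * Lf\<^sup>2 * L\<^sup>2 * Lg\<^sup>2 * (L + 1)\<^sup>2"

text \<open>
  In the absence of noise one step multiplies the Lyapunov function by at most \<open>drift\<close>; \<open>psi_weight\<close> is
  the total price of a unit of squared slow noise, paid in both equations.
\<close>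
definition "drift \<beta> = 1 - \<nu> / 2 * \<beta> + rate_quadratic * \<omega>\<^sup>2 * \<beta>\<^sup>2 + rate_cubic * \<omega>\<^sup>2 * \<beta> ^ 3"

definition "psi_weight \<beta> = c * (2 / \<mu>) * L\<^sup>2 * (1 / \<omega>\<^sup>2) * \<beta> + (2 * c * L\<^sup>2 * (1 / \<omega>) + 1) * \<beta>\<^sup>2
      + c * (2 / \<mu>) * Lf\<^sup>2 * L\<^sup>2 * \<beta> ^ 3"

lemma c_pos: "c > 0"
  unfolding c_eq using constants_pos mu_pos nu_pos by simp

lemma rate_quadratic_nonneg: "rate_quadratic \<ge> 0"
  unfolding rate_quadratic_def using constants_pos c_pos
  by (intro add_nonneg_nonneg mult_nonneg_nonneg) auto

lemma rate_cubic_nonneg: "rate_cubic \<ge> 0"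
  unfolding rate_cubic_def using constants_pos nu_pos by auto

text \<open>
  A pathwise bound. The right-hand side consists of functions of the current state, of the squared
  noises, and of inner products of the noises with functions of the current state. To first order
  the fast error contracts by \<open>\<omega> * \<mu> * \<beta>\<close>, of which one quarter absorbs the drift of the target
  and one quarter the coupling error of the slow equation; the remaining half dominates
  \<open>\<nu> / 2 * \<beta>\<close>. The slow error contracts by \<open>\<nu> * \<beta>\<close>, of which the coupling error of the fast
  equation takes at most half because \<open>c / \<omega> \<le> 1 / 2\<close>.
\<close>
lemma lyapunov_step:
  assumes b: "\<beta> > 0"
  defines "V \<equiv> lyapunov lam ystar c (\<omega> * \<beta>) \<beta>"
  shows "V (u - (\<omega> * \<beta>) *\<^sub>R (f u v + r)) (v - \<beta> *\<^sub>R (g u v + s)) \<le>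
      drift \<beta> * V u v + 2 * c * \<omega> * \<beta>\<^sup>2 * (norm r)\<^sup>2 + psi_weight \<beta> * (norm s)\<^sup>2
      + (- (2 * c * \<beta>) *\<^sub>R (u - lam v - (\<omega> * \<beta>) *\<^sub>R f u v)) \<bullet> r
      + ((4 * (c / \<omega>) * L\<^sup>2 * \<beta>\<^sup>2) *\<^sub>R g u v - (2 * \<beta>) *\<^sub>R (v - ystar - \<beta> *\<^sub>R g u v)) \<bullet> s"
proof -
  define a k A where "a = \<omega> * \<beta>" and "k = c / \<omega>" and "A = L * Lg * (L + 1)"
  define X Y where "X = (norm (u - lam v))\<^sup>2" and "Y = (norm (v - ystar))\<^sup>2"
  note pos = constants_pos mu_pos nu_pos c_pos b
  have w: "\<omega> > 0" and a: "a > 0" and k: "k > 0" "2 * k \<le> 1"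
    using omega_1 b c_pos omega_c by (auto simp: a_def k_def)
  have V: "V p q = k * (norm (p - lam q))\<^sup>2 + (norm (q - ystar))\<^sup>2" for p q
    using b by (simp add: V_def lyapunov_def k_def)
  have ka: "k * a = c * \<beta>" and w2: "\<omega>\<^sup>2 \<ge> 1"
    using w omega_1 by (auto simp: k_def a_def)
  define Fx where "Fx = 1 - a * \<mu> + a\<^sup>2 * Lf\<^sup>2 + 4 * L\<^sup>2 * Lg\<^sup>2 * \<beta>\<^sup>2
         + (2 * L * Lg + 2 / \<nu> * A\<^sup>2) * \<beta> + 2 * Lf * L * Lg * a * \<beta>
         + 2 / \<nu> * Lf\<^sup>2 * A\<^sup>2 * a\<^sup>2 * \<beta>"
  define Fy where "Fy = \<nu> * \<beta> + 4 * L\<^sup>2 * Lg\<^sup>2 * (L + 1)\<^sup>2 * \<beta>\<^sup>2"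
  define Sx where "Sx = \<beta> * (Lg\<^sup>2 / \<nu>) + \<beta>\<^sup>2 * (Lg\<^sup>2 * (L + 2))"
  define Sy where "Sy = 1 - \<beta> * \<nu> + \<beta>\<^sup>2 * (Lg\<^sup>2 * (2 * L\<^sup>2 + L + 3))"
  define N where "N = 2 / \<mu> * L\<^sup>2 * \<beta>\<^sup>2 / a + 2 * L\<^sup>2 * \<beta>\<^sup>2 + 2 / \<mu> * Lf\<^sup>2 * L\<^sup>2 * \<beta>\<^sup>2 * a"
  have A2: "A\<^sup>2 = L\<^sup>2 * Lg\<^sup>2 * (L + 1)\<^sup>2" by (simp add: A_def power_mult_distrib)
  have B2a: "rate_cubic * \<omega>\<^sup>2 * \<beta> ^ 3 = 2 / \<nu> * Lf\<^sup>2 * A\<^sup>2 * a\<^sup>2 * \<beta>"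
    unfolding rate_cubic_def A2 by (simp add: a_def power2_eq_square power3_eq_cube)
  have B2n: "rate_cubic * \<omega>\<^sup>2 * \<beta> ^ 3 \<ge> 0" using rate_cubic_nonneg b by simp
  have fast_rate: "(2 * L * Lg + 2 / \<nu> * A\<^sup>2) * \<beta> \<le> a * \<mu> / 4"
  proof -
    have "2 * L * Lg + 2 / \<nu> * A\<^sup>2 \<le> \<omega> * \<mu> / 4"
      using omega_fast pos by (simp add: A2 field_simps)
    hence "(2 * L * Lg + 2 / \<nu> * A\<^sup>2) * \<beta> \<le> \<omega> * \<mu> / 4 * \<beta>" using b by (intro mult_right_mono) auto
    thus ?thesis by (simp add: a_def mult_ac)
  qed
  have "\<omega> * \<mu> \<ge> \<nu>" using omega_ratio pos by (simp add: field_simps)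
  hence slow_rate: "a * \<mu> \<ge> \<nu> * \<beta>" using b by (simp add: a_def mult_ac)
  have sx1: "\<beta> * (Lg\<^sup>2 / \<nu>) = k * (a * \<mu> / 4)"
  proof -
    have "k * (a * \<mu> / 4) = c * \<mu> / 4 * \<beta>" using ka by (simp add: algebra_simps)
    also have "c * \<mu> / 4 = Lg\<^sup>2 / \<nu>" using pos by (simp add: c_eq field_simps)
    finally show ?thesis by simp
  qed
  have sx2: "\<beta>\<^sup>2 * (Lg\<^sup>2 * (L + 2)) \<le> k * (1 / c * Lg\<^sup>2 * (L + 2) * \<omega>\<^sup>2 * \<beta>\<^sup>2)"
  proof -
    have "k * (1 / c * Lg\<^sup>2 * (L + 2) * \<omega>\<^sup>2 * \<beta>\<^sup>2) = \<omega> * (\<beta>\<^sup>2 * (Lg\<^sup>2 * (L + 2)))"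
      using pos w by (simp add: k_def power2_eq_square)
    moreover have "1 * (\<beta>\<^sup>2 * (Lg\<^sup>2 * (L + 2))) \<le> \<omega> * (\<beta>\<^sup>2 * (Lg\<^sup>2 * (L + 2)))"
      using omega_1 pos by (intro mult_right_mono) auto
    ultimately show ?thesis by simp
  qed
  have coeff_x: "k * Fx + Sx \<le> drift \<beta> * k"
  proof -
    have e1: "4 * L\<^sup>2 * Lg\<^sup>2 * \<beta>\<^sup>2 \<le> 4 * L\<^sup>2 * Lg\<^sup>2 * \<omega>\<^sup>2 * \<beta>\<^sup>2"
      using mult_right_mono[OF w2, of "4 * L\<^sup>2 * Lg\<^sup>2 * \<beta>\<^sup>2"] by (simp add: mult_ac)
    have "\<omega> \<le> \<omega>\<^sup>2" using omega_1 by (simp add: power2_eq_square)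
    from mult_right_mono[OF this, of "2 * Lf * L * Lg * \<beta>\<^sup>2"]
    have e2: "2 * Lf * L * Lg * a * \<beta> \<le> 2 * Lf * L * Lg * \<omega>\<^sup>2 * \<beta>\<^sup>2"
      using pos by (simp add: a_def mult_ac power2_eq_square[of \<beta>])
    have e3: "0 \<le> 4 * c * L\<^sup>2 * Lg\<^sup>2 * (L + 1)\<^sup>2 * \<omega>\<^sup>2 * \<beta>\<^sup>2"
      "0 \<le> Lg\<^sup>2 * (2 * L\<^sup>2 + L + 3) * \<omega>\<^sup>2 * \<beta>\<^sup>2" using pos by auto
    have e4: "a\<^sup>2 * Lf\<^sup>2 = Lf\<^sup>2 * \<omega>\<^sup>2 * \<beta>\<^sup>2" by (simp add: a_def power_mult_distrib)
    have "rate_quadratic * \<omega>\<^sup>2 * \<beta>\<^sup>2 = Lf\<^sup>2 * \<omega>\<^sup>2 * \<beta>\<^sup>2 + 4 * L\<^sup>2 * Lg\<^sup>2 * \<omega>\<^sup>2 * \<beta>\<^sup>2 + 2 * Lf * L * Lg * \<omega>\<^sup>2 * \<beta>\<^sup>2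
        + 1 / c * Lg\<^sup>2 * (L + 2) * \<omega>\<^sup>2 * \<beta>\<^sup>2 + 4 * c * L\<^sup>2 * Lg\<^sup>2 * (L + 1)\<^sup>2 * \<omega>\<^sup>2 * \<beta>\<^sup>2
        + Lg\<^sup>2 * (2 * L\<^sup>2 + L + 3) * \<omega>\<^sup>2 * \<beta>\<^sup>2"
      unfolding rate_quadratic_def by (simp only: distrib_right)
    hence "Fx + (a * \<mu> / 4 + 1 / c * Lg\<^sup>2 * (L + 2) * \<omega>\<^sup>2 * \<beta>\<^sup>2) \<le> drift \<beta>"
      unfolding Fx_def drift_def B2a using fast_rate slow_rate e1 e2 e3 e4 by linarith
    hence "k * (Fx + (a * \<mu> / 4 + 1 / c * Lg\<^sup>2 * (L + 2) * \<omega>\<^sup>2 * \<beta>\<^sup>2)) \<le> k * drift \<beta>"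
      using k by (intro mult_left_mono) auto
    moreover have "k * (Fx + (a * \<mu> / 4 + 1 / c * Lg\<^sup>2 * (L + 2) * \<omega>\<^sup>2 * \<beta>\<^sup>2))
        = k * Fx + k * (a * \<mu> / 4) + k * (1 / c * Lg\<^sup>2 * (L + 2) * \<omega>\<^sup>2 * \<beta>\<^sup>2)"
      by (simp only: distrib_left add.assoc)
    ultimately show ?thesis
      unfolding Sx_def using sx1 sx2 by (simp only: mult.commute[of k "drift \<beta>"])
  qed
  have coeff_y: "k * Fy + Sy \<le> drift \<beta>"
  proof -
    have y1: "k * (\<nu> * \<beta>) \<le> \<nu> / 2 * \<beta>"
      using mult_right_mono[OF k(2), of "\<nu> * \<beta>"] pos by simp
    have "k \<le> c * \<omega>\<^sup>2"
    proof -
      have "k \<le> c" using omega_1 c_pos by (simp add: k_def field_simps)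
      also have "\<dots> \<le> c * \<omega>\<^sup>2" using w2 c_pos by simp
      finally show ?thesis .
    qed
    from mult_right_mono[OF this, of "4 * L\<^sup>2 * Lg\<^sup>2 * (L + 1)\<^sup>2 * \<beta>\<^sup>2"]
    have y2: "k * (4 * L\<^sup>2 * Lg\<^sup>2 * (L + 1)\<^sup>2 * \<beta>\<^sup>2)
        \<le> 4 * c * L\<^sup>2 * Lg\<^sup>2 * (L + 1)\<^sup>2 * (\<omega>\<^sup>2 * \<beta>\<^sup>2)" by (simp add: mult_ac)
    have y3: "\<beta>\<^sup>2 * (Lg\<^sup>2 * (2 * L\<^sup>2 + L + 3)) \<le> Lg\<^sup>2 * (2 * L\<^sup>2 + L + 3) * (\<omega>\<^sup>2 * \<beta>\<^sup>2)"
      using mult_right_mono[OF w2, of "\<beta>\<^sup>2 * (Lg\<^sup>2 * (2 * L\<^sup>2 + L + 3))"] pos by (simp add: mult_ac)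
    have y4: "0 \<le> (Lf\<^sup>2 + 4 * L\<^sup>2 * Lg\<^sup>2 + 2 * Lf * L * Lg + 1 / c * Lg\<^sup>2 * (L + 2)) * (\<omega>\<^sup>2 * \<beta>\<^sup>2)"
      using pos by simp
    have "rate_quadratic * \<omega>\<^sup>2 * \<beta>\<^sup>2 = (Lf\<^sup>2 + 4 * L\<^sup>2 * Lg\<^sup>2 + 2 * Lf * L * Lg + 1 / c * Lg\<^sup>2 * (L + 2)) * (\<omega>\<^sup>2 * \<beta>\<^sup>2)
        + 4 * c * L\<^sup>2 * Lg\<^sup>2 * (L + 1)\<^sup>2 * (\<omega>\<^sup>2 * \<beta>\<^sup>2) + Lg\<^sup>2 * (2 * L\<^sup>2 + L + 3) * (\<omega>\<^sup>2 * \<beta>\<^sup>2)"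
      unfolding rate_quadratic_def by (simp only: distrib_right mult.assoc)
    moreover have "k * Fy = k * (\<nu> * \<beta>) + k * (4 * L\<^sup>2 * Lg\<^sup>2 * (L + 1)\<^sup>2 * \<beta>\<^sup>2)"
      unfolding Fy_def by (rule distrib_left)
    ultimately show ?thesis
      unfolding Sy_def drift_def using y1 y2 y3 y4 B2n by (simp only: mult.commute[of \<beta> \<nu>])
  qed
  have noise_x: "k * (2 * a\<^sup>2) = 2 * c * \<omega> * \<beta>\<^sup>2"
    using w by (simp add: k_def a_def power2_eq_square)
  have noise_y: "k * N + \<beta>\<^sup>2 = psi_weight \<beta>"
    using w b unfolding psi_weight_def N_def k_def a_def
    by (simp add: divide_simps) (simp add: power2_eq_square power3_eq_cube algebra_simps)
  let ?p = "u - lam v - a *\<^sub>R f u v" and ?q = "v - ystar - \<beta> *\<^sub>R g u v"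
  let ?u = "u - a *\<^sub>R (f u v + r)" and ?v = "v - \<beta> *\<^sub>R (g u v + s)"
  have "(norm (?u - lam ?v))\<^sup>2 \<le> Fx * X + Fy * Y + 2 * a\<^sup>2 * (norm r)\<^sup>2 + N * (norm s)\<^sup>2
      - 2 * a * (?p \<bullet> r) + 4 * L\<^sup>2 * \<beta>\<^sup>2 * (g u v \<bullet> s)"
    using fast_step[OF a b, of u v r s] unfolding Fx_def Fy_def N_def A_def X_def Y_def .
  hence "k * (norm (?u - lam ?v))\<^sup>2 \<le> k * (Fx * X + Fy * Y + 2 * a\<^sup>2 * (norm r)\<^sup>2 + N * (norm s)\<^sup>2
      - 2 * a * (?p \<bullet> r) + 4 * L\<^sup>2 * \<beta>\<^sup>2 * (g u v \<bullet> s))"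
    using k by (intro mult_left_mono) auto
  moreover have "(norm (?v - ystar))\<^sup>2 \<le> Sx * X + Sy * Y + \<beta>\<^sup>2 * (norm s)\<^sup>2 - 2 * \<beta> * (?q \<bullet> s)"
    using slow_step[OF b, of v u s] unfolding Sx_def Sy_def X_def Y_def .
  ultimately have "V ?u ?v \<le> (k * Fx + Sx) * X + (k * Fy + Sy) * Y + k * (2 * a\<^sup>2) * (norm r)\<^sup>2
      + (k * N + \<beta>\<^sup>2) * (norm s)\<^sup>2 - 2 * (k * a) * (?p \<bullet> r)
      + 4 * k * L\<^sup>2 * \<beta>\<^sup>2 * (g u v \<bullet> s) - 2 * \<beta> * (?q \<bullet> s)"
    unfolding V by (simp add: algebra_simps)
  moreover have "(k * Fx + Sx) * X \<le> drift \<beta> * k * X" "(k * Fy + Sy) * Y \<le> drift \<beta> * Y"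
    using coeff_x coeff_y by (auto intro!: mult_right_mono simp: X_def Y_def)
  ultimately have "V ?u ?v \<le> drift \<beta> * (k * X + Y) + 2 * c * \<omega> * \<beta>\<^sup>2 * (norm r)\<^sup>2
      + psi_weight \<beta> * (norm s)\<^sup>2 - 2 * (c * \<beta>) * (?p \<bullet> r)
      + 4 * k * L\<^sup>2 * \<beta>\<^sup>2 * (g u v \<bullet> s) - 2 * \<beta> * (?q \<bullet> s)"
    unfolding noise_x noise_y ka by (simp add: algebra_simps)
  thus ?thesis
    unfolding V X_def Y_def a_def k_def by (simp add: inner_diff_left)
qed

text \<open>
  These bounds convert any quadratic function of the state into a multiple of the Lyapunov function.
\<close>
lemma lyapunov_bounds:
  assumes "\<beta> > 0"
  defines "V \<equiv> lyapunov lam ystar c (\<omega> * \<beta>) \<beta>"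
  shows "V u v \<ge> 0" "(norm (u - lam v))\<^sup>2 \<le> 1 / c * \<omega> * V u v" "(norm (v - ystar))\<^sup>2 \<le> V u v"
proof -
  have w: "\<omega> > 0" using omega_1 by simp
  have V: "V u v = c / \<omega> * (norm (u - lam v))\<^sup>2 + (norm (v - ystar))\<^sup>2"
    using assms by (simp add: V_def lyapunov_def)
  have nonneg: "c / \<omega> * (norm (u - lam v))\<^sup>2 \<ge> 0" using w c_pos by simp
  thus "V u v \<ge> 0" "(norm (v - ystar))\<^sup>2 \<le> V u v" by (auto simp: V)
  have "1 / c * \<omega> * (c / \<omega> * (norm (u - lam v))\<^sup>2) \<le> 1 / c * \<omega> * V u v"
    using w c_pos by (intro mult_left_mono) (auto simp: V)
  thus "(norm (u - lam v))\<^sup>2 \<le> 1 / c * \<omega> * V u v" using w c_pos by simp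
qed

lemma weighted_variance_le:
  assumes "\<beta> > 0" "G1 \<ge> 0" "G2 \<ge> 0"
  shows "G1 * (norm (u - lam v))\<^sup>2 + G2 * (norm (v - ystar))\<^sup>2
    \<le> (G1 * (1 / c) * \<omega> + G2) * lyapunov lam ystar c (\<omega> * \<beta>) \<beta> u v"
  using mult_left_mono[OF lyapunov_bounds(2)[OF assms(1), of u v] assms(2)]
    mult_left_mono[OF lyapunov_bounds(3)[OF assms(1), of v u] assms(3)]
  by (simp add: algebra_simps)

lemma psi_weight_nonneg: "\<beta> > 0 \<Longrightarrow> psi_weight \<beta> \<ge> 0"
  unfolding psi_weight_def using c_pos mu_pos omega_1 by (intro add_nonneg_nonneg mult_nonneg_nonneg) auto

end

section \<open>Conditionally centred noise\<close>

text \<open>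
  Square integrability of both factors makes each coordinate product integrable, which is what the
  defining property of the conditional expectation requires.
\<close>
lemma (in sigma_finite_subalgebra) inner_cond_centred:
  fixes h n :: "'a \<Rightarrow> real ^ 'n"
  assumes h[measurable]: "h \<in> borel_measurable F" and n[measurable]: "n \<in> borel_measurable M"
    and hsq: "integrable M (\<lambda>w. (norm (h w))\<^sup>2)" and nsq: "integrable M (\<lambda>w. (norm (n w))\<^sup>2)"
    and centred: "\<And>i. AE w in M. real_cond_exp M F (\<lambda>w. n w $ i) w = 0"
  shows "integrable M (\<lambda>w. h w \<bullet> n w)" and "(\<integral>w. h w \<bullet> n w \<partial>M) = 0"
proof -
  have hi: "(\<lambda>w. h w $ i) \<in> borel_measurable F" for i
    by (intro borel_measurable_continuous_on[OF _ h] continuous_intros)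
  have ni: "(\<lambda>w. n w $ i) \<in> borel_measurable M" for i
    by (intro borel_measurable_continuous_on[OF _ n] continuous_intros)
  have int: "integrable M (\<lambda>w. h w $ i * n w $ i)" for i
  proof (rule Bochner_Integration.integrable_bound[OF Bochner_Integration.integrable_add[OF hsq nsq]])
    show "AE w in M. norm (h w $ i * n w $ i) \<le> norm ((norm (h w))\<^sup>2 + (norm (n w))\<^sup>2)"
    proof (intro AE_I2)
      fix w
      have "\<bar>h w $ i\<bar> * \<bar>n w $ i\<bar> \<le> norm (h w) * norm (n w)"
        by (intro mult_mono component_le_norm_cart) auto
      also have "\<dots> \<le> (norm (h w))\<^sup>2 + (norm (n w))\<^sup>2"
        using sum_squares_bound[of "norm (h w)" "norm (n w)"]
          mult_nonneg_nonneg[OF norm_ge_zero[of "h w"] norm_ge_zero[of "n w"]] by linarith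
      finally show "norm (h w $ i * n w $ i) \<le> norm ((norm (h w))\<^sup>2 + (norm (n w))\<^sup>2)"
        by (simp add: abs_mult)
    qed
  qed (intro borel_measurable_times measurable_from_subalg[OF subalg hi] ni)
  have hiM[measurable]: "(\<lambda>w. h w $ i) \<in> borel_measurable M" for i
    by (rule measurable_from_subalg[OF subalg hi])
  have zero: "(\<integral>w. h w $ i * n w $ i \<partial>M) = 0" for i
  proof -
    have "(\<integral>w. h w $ i * n w $ i \<partial>M) = (\<integral>w. h w $ i * real_cond_exp M F (\<lambda>w. n w $ i) w \<partial>M)"
      using real_cond_exp_intg(2)[OF int hi ni] by simp
    also have "\<dots> = (\<integral>w. 0 \<partial>M)"
      using centred[of i] by (intro integral_cong_AE) auto
    finally show ?thesis by simp
  qed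
  show "integrable M (\<lambda>w. h w \<bullet> n w)" unfolding inner_vec_def using int by simp
  show "(\<integral>w. h w \<bullet> n w \<partial>M) = 0" unfolding inner_vec_def using int zero by simp
qed

text \<open>
  The nonnegative conditional expectation is meaningful without integrability, so a bound on it
  yields square integrability instead of presupposing it.
\<close>
lemma (in sigma_finite_subalgebra) second_moment_le:
  fixes n :: "'a \<Rightarrow> 'b::{real_normed_vector, second_countable_topology}"
  assumes n[measurable]: "n \<in> borel_measurable M"
    and q: "integrable M q" "\<And>w. q w \<ge> 0"
    and bound: "AE w in M. nn_cond_exp M F (\<lambda>w. ennreal ((norm (n w))\<^sup>2)) w \<le> ennreal (q w)"
  shows "integrable M (\<lambda>w. (norm (n w))\<^sup>2)" and "(\<integral>w. (norm (n w))\<^sup>2 \<partial>M) \<le> (\<integral>w. q w \<partial>M)"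
proof -
  have "(\<integral>\<^sup>+ w. ennreal ((norm (n w))\<^sup>2) \<partial>M)
      = (\<integral>\<^sup>+ w. nn_cond_exp M F (\<lambda>w. ennreal ((norm (n w))\<^sup>2)) w \<partial>M)"
    using nn_cond_exp_intg[of "\<lambda>_. 1" "\<lambda>w. ennreal ((norm (n w))\<^sup>2)"] by simp
  also have "\<dots> \<le> (\<integral>\<^sup>+ w. ennreal (q w) \<partial>M)" using bound by (rule nn_integral_mono_AE)
  also have "\<dots> = ennreal (\<integral>w. q w \<partial>M)" using q by (intro nn_integral_eq_integral) auto
  finally have le: "(\<integral>\<^sup>+ w. ennreal ((norm (n w))\<^sup>2) \<partial>M) \<le> ennreal (\<integral>w. q w \<partial>M)" .
  show *: "integrable M (\<lambda>w. (norm (n w))\<^sup>2)"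
    using le by (intro integrableI_nonneg) (auto simp: top_unique less_top[symmetric])
  have "ennreal (\<integral>w. (norm (n w))\<^sup>2 \<partial>M) \<le> ennreal (\<integral>w. q w \<partial>M)"
    using le nn_integral_eq_integral[OF *] by simp
  moreover have "0 \<le> (\<integral>w. q w \<partial>M)" using q by (intro integral_nonneg_AE) auto
  ultimately show "(\<integral>w. (norm (n w))\<^sup>2 \<partial>M) \<le> (\<integral>w. q w \<partial>M)" by simp
qed

lemma integrable_norm_square_diff:
  fixes a b :: "'a \<Rightarrow> 'b::{real_inner, second_countable_topology}"
  assumes [measurable]: "a \<in> borel_measurable M" "b \<in> borel_measurable M"
    and int: "integrable M (\<lambda>w. (norm (a w))\<^sup>2)" "integrable M (\<lambda>w. (norm (b w))\<^sup>2)"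
  shows "integrable M (\<lambda>w. (norm (a w - b w))\<^sup>2)"
proof (rule Bochner_Integration.integrable_bound)
  show "integrable M (\<lambda>w. 2 * (norm (a w))\<^sup>2 + 2 * (norm (b w))\<^sup>2)" using int by simp
  show "AE w in M. norm ((norm (a w - b w))\<^sup>2) \<le> norm (2 * (norm (a w))\<^sup>2 + 2 * (norm (b w))\<^sup>2)"
  proof (intro AE_I2)
    fix w
    have "(norm (a w - b w))\<^sup>2 \<le> 2 * (norm (a w))\<^sup>2 + 2 * (norm (b w))\<^sup>2"
      using zero_le_power2[of "norm (a w + b w)"] unfolding power2_norm_eq_inner
      by (simp add: algebra_simps inner_commute)
    thus "norm ((norm (a w - b w))\<^sup>2) \<le> norm (2 * (norm (a w))\<^sup>2 + 2 * (norm (b w))\<^sup>2)" by simp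
  qed
qed measurable

context two_time_scale_process
begin

abbreviation "history \<equiv> noise_history M (x 0) (y 0) \<xi> \<psi>"

lemma sets_history: "sets (history k) = sigma_sets (space M)
     ({x 0 -` A \<inter> space M | A. A \<in> sets borel} \<union>
      {y 0 -` B \<inter> space M | B. B \<in> sets borel} \<union>
      {\<xi> j -` A \<inter> space M | j A. j < k \<and> A \<in> sets borel} \<union>
      {\<psi> j -` B \<inter> space M | j B. j < k \<and> B \<in> sets borel})"
  unfolding noise_history_def by (intro sets_measure_of) auto

lemma space_history: "space (history k) = space M"
  unfolding noise_history_def by (intro space_measure_of) auto

lemma initial_measurable: "x 0 \<in> borel_measurable N" "y 0 \<in> borel_measurable N"
  if "space N = space M"
proof -
  show "x 0 \<in> borel_measurable N"
    using measurable_cong[of N "x 0" "\<lambda>_. x0" borel] init(1) that by simp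
  show "y 0 \<in> borel_measurable N"
    using measurable_cong[of N "y 0" "\<lambda>_. y0" borel] init(2) that by simp
qed

lemma subalgebra_history: "subalgebra M (history k)"
proof -
  have "sets (history k) \<subseteq> sets M"
    unfolding sets_history
    using measurable_sets[OF initial_measurable(1)[OF refl]]
      measurable_sets[OF initial_measurable(2)[OF refl]]
      measurable_sets[OF noise_measurable(1)] measurable_sets[OF noise_measurable(2)]
    by (intro sets.sigma_sets_subset) auto
  thus ?thesis by (simp add: subalgebra_def space_history)
qed

lemma noise_measurable_history:
  assumes "j < k"
  shows "\<xi> j \<in> borel_measurable (history k)" "\<psi> j \<in> borel_measurable (history k)"
  using assms by (auto intro!: measurableI sigma_sets.Basic simp: space_history sets_history)

lemma history_mono: "subalgebra (history (Suc k)) (history k)"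
  unfolding subalgebra_def space_history sets_history
  by (auto intro!: sigma_sets_mono' dest: less_SucI) 

lemma state_measurable:
  assumes "continuous_on UNIV (\<lambda>(u, v). f u v)" "continuous_on UNIV (\<lambda>(u, v). g u v)"
  shows "x k \<in> borel_measurable (history k) \<and> y k \<in> borel_measurable (history k)"
proof (induction k)
  case 0
  show ?case by (simp add: initial_measurable space_history)
next
  case (Suc k)
  have [measurable]: "x k \<in> borel_measurable (history (Suc k))"
    "y k \<in> borel_measurable (history (Suc k))"
    using Suc measurable_from_subalg[OF history_mono] by auto
  have [measurable]: "\<xi> k \<in> borel_measurable (history (Suc k))"
    "\<psi> k \<in> borel_measurable (history (Suc k))"
    by (simp_all add: noise_measurable_history)
  have [measurable]: "(\<lambda>w. f (x k w) (y k w)) \<in> borel_measurable (history (Suc k))"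
    "(\<lambda>w. g (x k w) (y k w)) \<in> borel_measurable (history (Suc k))"
    using borel_measurable_continuous_on[OF assms(1), of "\<lambda>w. (x k w, y k w)" "history (Suc k)"]
      borel_measurable_continuous_on[OF assms(2), of "\<lambda>w. (x k w, y k w)" "history (Suc k)"] by auto
  have "(\<lambda>w. x k w - \<alpha> *\<^sub>R (f (x k w) (y k w) + \<xi> k w)) \<in> borel_measurable (history (Suc k))"
    "(\<lambda>w. y k w - \<beta> *\<^sub>R (g (x k w) (y k w) + \<psi> k w)) \<in> borel_measurable (history (Suc k))"
    by measurable
  moreover have "x (Suc k) \<in> borel_measurable (history (Suc k)) \<longleftrightarrow>
      (\<lambda>w. x k w - \<alpha> *\<^sub>R (f (x k w) (y k w) + \<xi> k w)) \<in> borel_measurable (history (Suc k))"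
    by (rule measurable_cong) (simp add: x_step space_history)
  moreover have "y (Suc k) \<in> borel_measurable (history (Suc k)) \<longleftrightarrow>
      (\<lambda>w. y k w - \<beta> *\<^sub>R (g (x k w) (y k w) + \<psi> k w)) \<in> borel_measurable (history (Suc k))"
    by (rule measurable_cong) (simp add: y_step space_history)
  ultimately show ?case by simp
qed

lemma sigma_finite_subalgebra_history: "sigma_finite_subalgebra M (history k)"
  by (intro finite_measure_subalgebra_is_sigma_finite finite_measure_subalgebra.intro
      finite_measure_axioms finite_measure_subalgebra_axioms.intro subalgebra_history)

end

section \<open>Decay of the expected Lyapunov function\<close>

context separated_time_scales
begin

text \<open>
  Integrability travels with the estimate: if \<open>V k\<close> is integrable, then so are the squares of the
  noises, by their conditional variance bounds, and the squares of all state functions that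
  multiply them, by linear growth. The linear noise terms therefore have mean zero, and the
  pathwise bound dominates \<open>V (Suc k)\<close> by an integrable function.
\<close>
lemma lyapunov_expectation_step:
  assumes b: "\<beta> > 0" and G: "\<Gamma>11 \<ge> 0" "\<Gamma>12 \<ge> 0" "\<Gamma>21 \<ge> 0" "\<Gamma>22 \<ge> 0"
    and proc: "two_time_scale_process M f g lam ystar \<Gamma>11 \<Gamma>12 \<Gamma>21 \<Gamma>22 (\<omega> * \<beta>) \<beta> x0 y0 \<xi> \<psi> x y"
  defines "V k w \<equiv> lyapunov lam ystar c (\<omega> * \<beta>) \<beta> (x k w) (y k w)"
  assumes int: "integrable M (V k)"
  shows "integrable M (V (Suc k))"
    and "(\<integral>w. V (Suc k) w \<partial>M) \<le> (drift \<beta> + 2 * c * \<omega> * \<beta>\<^sup>2 * (\<Gamma>11 * (1 / c) * \<omega> + \<Gamma>12)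
      + psi_weight \<beta> * (\<Gamma>21 * (1 / c) * \<omega> + \<Gamma>22)) * (\<integral>w. V k w \<partial>M)"
proof -
  interpret P: two_time_scale_process M f g lam ystar \<Gamma>11 \<Gamma>12 \<Gamma>21 \<Gamma>22 "\<omega> * \<beta>" \<beta> x0 y0 \<xi> \<psi> x y
    by (rule proc)
  interpret H: sigma_finite_subalgebra M "P.history k" by (rule P.sigma_finite_subalgebra_history)
  note bounds = lyapunov_bounds[OF b]
  note state = P.state_measurable[OF maps_continuous(1,2)]
  have V_nonneg: "V j w \<ge> 0" for j w unfolding V_def by (rule bounds(1))
  have V_meas: "V j \<in> borel_measurable M" for j
  proof -
    have [measurable]: "x j \<in> borel_measurable M" "y j \<in> borel_measurable M"
      using state[of j] measurable_from_subalg[OF P.subalgebra_history] by auto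
    have [measurable]: "(\<lambda>w. lam (y j w)) \<in> borel_measurable M"
      by (rule borel_measurable_continuous_on[OF maps_continuous(3)]) measurable
    show ?thesis unfolding V_def lyapunov_def by measurable
  qed
  note [measurable] = P.noise_measurable
  let ?G1 = "\<Gamma>11 * (1 / c) * \<omega> + \<Gamma>12" and ?G2 = "\<Gamma>21 * (1 / c) * \<omega> + \<Gamma>22"
  have G_nonneg: "?G1 \<ge> 0" "?G2 \<ge> 0" using G c_pos omega_1 by auto
  have xi_bound: "AE w in M. nn_cond_exp M (P.history k) (\<lambda>w. ennreal ((norm (\<xi> k w))\<^sup>2)) w
      \<le> ennreal (?G1 * V k w)"
    using P.xi_second_moment[of k]
    by eventually_elim
      (rule order_trans, assumption, unfold V_def, intro ennreal_leI weighted_variance_le b G)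
  have psi_bound: "AE w in M. nn_cond_exp M (P.history k) (\<lambda>w. ennreal ((norm (\<psi> k w))\<^sup>2)) w
      \<le> ennreal (?G2 * V k w)"
    using P.psi_second_moment[of k]
    by eventually_elim
      (rule order_trans, assumption, unfold V_def, intro ennreal_leI weighted_variance_le b G)
  have GV: "integrable M (\<lambda>w. ?G1 * V k w)" "integrable M (\<lambda>w. ?G2 * V k w)" using int by auto
  have GV_nonneg: "?G1 * V k w \<ge> 0" "?G2 * V k w \<ge> 0" for w using G_nonneg V_nonneg by auto
  note xi2 = H.second_moment_le[OF P.noise_measurable(1) GV(1) GV_nonneg(1) xi_bound]
  note psi2 = H.second_moment_le[OF P.noise_measurable(2) GV(2) GV_nonneg(2) psi_bound]

  have xm[measurable]: "x k \<in> borel_measurable (P.history k)"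
    and ym[measurable]: "y k \<in> borel_measurable (P.history k)"
    using state[of k] by auto
  define fk gk xh yh where "fk = (\<lambda>w. f (x k w) (y k w))" and "gk = (\<lambda>w. g (x k w) (y k w))"
    and "xh = (\<lambda>w. x k w - lam (y k w))" and "yh = (\<lambda>w. y k w - ystar)"
  have hm[measurable]: "fk \<in> borel_measurable (P.history k)" "gk \<in> borel_measurable (P.history k)"
    "xh \<in> borel_measurable (P.history k)" "yh \<in> borel_measurable (P.history k)"
    using borel_measurable_continuous_on[OF maps_continuous(1), of "\<lambda>w. (x k w, y k w)" "P.history k"]
      borel_measurable_continuous_on[OF maps_continuous(2), of "\<lambda>w. (x k w, y k w)" "P.history k"]
      borel_measurable_continuous_on[OF maps_continuous(3) ym]
    by (auto simp: fk_def gk_def xh_def yh_def)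
  note hM[measurable] = hm[THEN measurable_from_subalg[OF P.subalgebra_history]]
  have dominated: "integrable M (\<lambda>w. (norm (a w))\<^sup>2)"
    if "\<And>w. (norm (a w))\<^sup>2 \<le> C * V k w" "a \<in> borel_measurable M"
    for a :: "_ \<Rightarrow> 'z::{real_normed_vector, second_countable_topology}" and C
  proof (rule Bochner_Integration.integrable_bound)
    show "integrable M (\<lambda>w. C * V k w)" using int by simp
    show "(\<lambda>w. (norm (a w))\<^sup>2) \<in> borel_measurable M" using that(2) by measurable
    show "AE w in M. norm ((norm (a w))\<^sup>2) \<le> norm (C * V k w)"
      using that(1) by (intro AE_I2) (auto intro: order_trans[OF _ abs_ge_self])
  qed
  have sq: "integrable M (\<lambda>w. (norm (xh w))\<^sup>2)" "integrable M (\<lambda>w. (norm (yh w))\<^sup>2)"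
    "integrable M (\<lambda>w. (norm (fk w))\<^sup>2)" "integrable M (\<lambda>w. (norm (gk w))\<^sup>2)"
  proof -
    show "integrable M (\<lambda>w. (norm (xh w))\<^sup>2)"
      by (rule dominated[of xh "1 / c * \<omega>", OF _ hM(3)]) (simp only: xh_def V_def bounds)
    show "integrable M (\<lambda>w. (norm (yh w))\<^sup>2)"
      by (rule dominated[of yh 1, OF _ hM(4)]) (simp only: yh_def V_def bounds mult_1)
    show "integrable M (\<lambda>w. (norm (fk w))\<^sup>2)"
    proof (rule dominated)
      fix w
      have "(norm (fk w))\<^sup>2 \<le> (Lf * norm (x k w - lam (y k w)))\<^sup>2"
        unfolding fk_def by (intro power_mono norm_f_le) auto
      also have "\<dots> = Lf\<^sup>2 * (norm (x k w - lam (y k w)))\<^sup>2 + 0 * (norm (y k w - ystar))\<^sup>2"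
        by (simp add: power_mult_distrib)
      also have "\<dots> \<le> (Lf\<^sup>2 * (1 / c) * \<omega> + 0) * V k w"
        unfolding V_def by (rule weighted_variance_le) (use b in auto)
      finally show "(norm (fk w))\<^sup>2 \<le> (Lf\<^sup>2 * (1 / c) * \<omega> + 0) * V k w" .
    qed (rule hM)
    show "integrable M (\<lambda>w. (norm (gk w))\<^sup>2)"
    proof (rule dominated)
      fix w
      have "(norm (gk w))\<^sup>2 \<le> 2 * Lg\<^sup>2 * (norm (x k w - lam (y k w)))\<^sup>2
          + 2 * Lg\<^sup>2 * (L + 1)\<^sup>2 * (norm (y k w - ystar))\<^sup>2"
        unfolding gk_def by (rule norm_g_square_le)
      also have "\<dots> \<le> (2 * Lg\<^sup>2 * (1 / c) * \<omega> + 2 * Lg\<^sup>2 * (L + 1)\<^sup>2) * V k w"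
        unfolding V_def by (rule weighted_variance_le) (use b in auto)
      finally show "(norm (gk w))\<^sup>2 \<le> (2 * Lg\<^sup>2 * (1 / c) * \<omega> + 2 * Lg\<^sup>2 * (L + 1)\<^sup>2) * V k w" .
    qed (rule hM)
  qed
  define h1 where "h1 = (\<lambda>w. (- (2 * c * \<beta>)) *\<^sub>R (xh w - (\<omega> * \<beta>) *\<^sub>R fk w))"
  define h2 where "h2 = (\<lambda>w. (4 * (c / \<omega>) * L\<^sup>2 * \<beta>\<^sup>2) *\<^sub>R gk w - (2 * \<beta>) *\<^sub>R (yh w - \<beta> *\<^sub>R gk w))"
  have scale: "integrable M (\<lambda>w. (norm (t *\<^sub>R a w))\<^sup>2)" if "integrable M (\<lambda>w. (norm (a w))\<^sup>2)"
    for t and a :: "_ \<Rightarrow> 'z::real_normed_vector"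
    using that by (simp add: power_mult_distrib)
  have h1_sq: "integrable M (\<lambda>w. (norm (h1 w))\<^sup>2)"
    unfolding h1_def by (intro scale integrable_norm_square_diff sq) measurable
  have h2_sq: "integrable M (\<lambda>w. (norm (h2 w))\<^sup>2)"
    unfolding h2_def by (intro scale integrable_norm_square_diff sq) measurable
  have h1_m: "h1 \<in> borel_measurable (P.history k)" and h2_m: "h2 \<in> borel_measurable (P.history k)"
    unfolding h1_def h2_def by measurable
  note xi_orth = H.inner_cond_centred[OF h1_m P.noise_measurable(1) h1_sq xi2(1) P.xi_mean]
  note psi_orth = H.inner_cond_centred[OF h2_m P.noise_measurable(2) h2_sq psi2(1) P.psi_mean]

  define R where "R = (\<lambda>w. drift \<beta> * V k w + 2 * c * \<omega> * \<beta>\<^sup>2 * (norm (\<xi> k w))\<^sup>2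
      + psi_weight \<beta> * (norm (\<psi> k w))\<^sup>2 + h1 w \<bullet> \<xi> k w + h2 w \<bullet> \<psi> k w)"
  have R_int: "integrable M R"
    unfolding R_def using int xi2(1) psi2(1) xi_orth(1) psi_orth(1) by simp
  have step: "V (Suc k) w \<le> R w" if "w \<in> space M" for w
    using lyapunov_step[OF b, of "x k w" "y k w" "\<xi> k w" "\<psi> k w"] that
    by (simp add: V_def R_def h1_def h2_def fk_def gk_def xh_def yh_def P.x_step P.y_step)
  show V_int: "integrable M (V (Suc k))"
  proof (rule Bochner_Integration.integrable_bound[OF R_int V_meas])
    show "AE w in M. norm (V (Suc k) w) \<le> norm (R w)"
      using step V_nonneg by (intro AE_I2) (auto intro: order_trans[OF _ abs_ge_self])
  qed
  have "(\<integral>w. V (Suc k) w \<partial>M) \<le> (\<integral>w. R w \<partial>M)"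
    using step by (intro integral_mono V_int R_int) auto
  also have "\<dots> = drift \<beta> * (\<integral>w. V k w \<partial>M) + 2 * c * \<omega> * \<beta>\<^sup>2 * (\<integral>w. (norm (\<xi> k w))\<^sup>2 \<partial>M)
      + psi_weight \<beta> * (\<integral>w. (norm (\<psi> k w))\<^sup>2 \<partial>M)"
    unfolding R_def using int xi2(1) psi2(1) xi_orth psi_orth by simp
  also have "\<dots> \<le> drift \<beta> * (\<integral>w. V k w \<partial>M) + 2 * c * \<omega> * \<beta>\<^sup>2 * (\<integral>w. ?G1 * V k w \<partial>M)
      + psi_weight \<beta> * (\<integral>w. ?G2 * V k w \<partial>M)"
    using xi2(2) psi2(2) c_pos omega_1 b psi_weight_nonneg[OF b]
    by (intro add_mono mult_left_mono order_refl) auto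
  also have "\<dots> = (drift \<beta> + 2 * c * \<omega> * \<beta>\<^sup>2 * ?G1 + psi_weight \<beta> * ?G2) * (\<integral>w. V k w \<partial>M)"
    unfolding integral_mult_right_zero by (simp only: distrib_right mult.assoc)
  finally show "(\<integral>w. V (Suc k) w \<partial>M) \<le> \<dots>" .
qed

lemma lyapunov_decay:
  assumes b: "\<beta> > 0" and G: "\<Gamma>11 \<ge> 0" "\<Gamma>12 \<ge> 0" "\<Gamma>21 \<ge> 0" "\<Gamma>22 \<ge> 0"
    and proc: "two_time_scale_process M f g lam ystar \<Gamma>11 \<Gamma>12 \<Gamma>21 \<Gamma>22 (\<omega> * \<beta>) \<beta> x0 y0 \<xi> \<psi> x y"
    and rho: "drift \<beta> + 2 * c * \<omega> * \<beta>\<^sup>2 * (\<Gamma>11 * (1 / c) * \<omega> + \<Gamma>12)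
      + psi_weight \<beta> * (\<Gamma>21 * (1 / c) * \<omega> + \<Gamma>22) = \<rho>" "\<rho> \<ge> 0"
  defines "V k w \<equiv> lyapunov lam ystar c (\<omega> * \<beta>) \<beta> (x k w) (y k w)"
  shows "integrable M (V k)
    \<and> (\<integral>w. V k w \<partial>M) \<le> \<rho> ^ k * lyapunov lam ystar c (\<omega> * \<beta>) \<beta> x0 y0"
proof (induction k)
  interpret P: two_time_scale_process M f g lam ystar \<Gamma>11 \<Gamma>12 \<Gamma>21 \<Gamma>22 "\<omega> * \<beta>" \<beta> x0 y0 \<xi> \<psi> x y
    by (rule proc)
  let ?V0 = "lyapunov lam ystar c (\<omega> * \<beta>) \<beta> x0 y0"
  {
    case 0
    have const: "V 0 w = ?V0" if "w \<in> space M" for w using that by (simp add: V_def P.init)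
    hence "integrable M (V 0) \<longleftrightarrow> integrable M (\<lambda>_. ?V0)"
      by (intro Bochner_Integration.integrable_cong) auto
    moreover have "(\<integral>w. V 0 w \<partial>M) = (\<integral>w. ?V0 \<partial>M)"
      using const by (intro Bochner_Integration.integral_cong) auto
    ultimately show ?case by (simp add: P.prob_space)
  next
    case (Suc k)
    note step = lyapunov_expectation_step[OF b G proc, of k, folded V_def, unfolded rho(1)]
    have "(\<integral>w. V (Suc k) w \<partial>M) \<le> \<rho> * (\<integral>w. V k w \<partial>M)" using step Suc by blast
    also have "\<dots> \<le> \<rho> * (\<rho> ^ k * ?V0)" using Suc rho(2) by (intro mult_left_mono) auto
    finally show ?case using step(1) Suc by simp
  }
qed

end

text \<open>
  Near \<open>0\<close> the linear term decides the sign of the increment, while the value stays close to \<open>1\<close>.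
\<close>
lemma cubic_below_one:
  fixes d1 d2 d3 :: real
  assumes "d1 < 0" "d2 \<ge> 0" "d3 \<ge> 0"
  shows "\<exists>\<beta>>0. 0 < 1 + d1 * \<beta> + d2 * \<beta>^2 + d3 * \<beta>^3 \<and> 1 + d1 * \<beta> + d2 * \<beta>^2 + d3 * \<beta>^3 < 1"
proof -
  let ?p = "\<lambda>\<beta>. d1 + d2 * \<beta> + d3 * \<beta>^2" and ?q = "\<lambda>\<beta>. 1 + d1 * \<beta> + d2 * \<beta>^2 + d3 * \<beta>^3"
  have p: "(?p \<longlongrightarrow> ?p 0) (at_right 0)" and q: "(?q \<longlongrightarrow> ?q 0) (at_right 0)"
    by (intro tendsto_intros)+
  have "\<forall>\<^sub>F \<beta> in at_right 0. ?p \<beta> < 0" by (rule order_tendstoD(2)[OF p]) (use assms in simp)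
  moreover have "\<forall>\<^sub>F \<beta> in at_right 0. ?q \<beta> > 0" by (rule order_tendstoD(1)[OF q]) simp
  moreover have "\<forall>\<^sub>F \<beta> in at_right (0::real). \<beta> > 0" by (rule eventually_at_right_less)
  ultimately have "\<forall>\<^sub>F \<beta> in at_right 0. \<beta> > 0 \<and> ?p \<beta> < 0 \<and> ?q \<beta> > 0" by eventually_elim simp
  hence "\<exists>\<beta>. \<beta> > 0 \<and> ?p \<beta> < 0 \<and> ?q \<beta> > 0" by (rule eventually_happens'[rotated]) simp
  then obtain \<beta> where \<beta>: "\<beta> > 0" "?p \<beta> < 0" "?q \<beta> > 0" by blast
  have "?q \<beta> = 1 + \<beta> * ?p \<beta>" by (simp add: algebra_simps power2_eq_square power3_eq_cube)
  moreover have "\<beta> * ?p \<beta> < 0" using \<beta> by (simp add: mult_pos_neg)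
  ultimately have "?q \<beta> < 1" by linarith
  with \<beta> show ?thesis by blast
qed

theorem theoremS2:
  fixes f :: "real ^ 'd1 \<Rightarrow> real ^ 'd2 \<Rightarrow> real ^ 'd1"
    and g :: "real ^ 'd1 \<Rightarrow> real ^ 'd2 \<Rightarrow> real ^ 'd2"
    and lam :: "real ^ 'd2 \<Rightarrow> real ^ 'd1"
    and xstar :: "real ^ 'd1" and ystar :: "real ^ 'd2"
    and L\<^sub>f L\<^sub>g L\<^sub>l \<mu>\<^sub>f \<mu>\<^sub>g :: real
    and \<Gamma>11 \<Gamma>12 \<Gamma>21 \<Gamma>22 :: real
    and c B1 B2 \<omega> :: real
    and D1 D2 D3 :: "real \<Rightarrow> real"
  assumes root: "f xstar ystar = 0" "g xstar ystar = 0"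
    and root_unique: "\<And>x y. f x y = 0 \<Longrightarrow> g x y = 0 \<Longrightarrow> x = xstar \<and> y = ystar"
    and lam_root: "\<And>y. f (lam y) y = 0"
    and lam_unique: "\<And>x y. f x y = 0 \<Longrightarrow> x = lam y"
    and lam_lipschitz: "\<And>y1 y2. norm (lam y1 - lam y2) \<le> L\<^sub>l * norm (y1 - y2)"
    and f_lipschitz: "\<And>x1 y1 x2 y2.
      norm (f x1 y1 - f x2 y2) \<le> L\<^sub>f * (norm (x1 - x2) + norm (y1 - y2))"
    and mu_f_pos: "\<mu>\<^sub>f > 0"
    and f_monotone: "\<And>x1 x2 y. (x1 - x2) \<bullet> (f x1 y - f x2 y) \<ge> \<mu>\<^sub>f * (norm (x1 - x2))\<^sup>2"
    and g_lipschitz: "\<And>x1 y1 x2 y2.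
      norm (g x1 y1 - g x2 y2) \<le> L\<^sub>g * (norm (x1 - x2) + norm (y1 - y2))"
    and mu_g_pos: "\<mu>\<^sub>g > 0"
    and g_monotone: "\<And>y. (y - ystar) \<bullet> g (lam y) y \<ge> \<mu>\<^sub>g * (norm (y - ystar))\<^sup>2"
    and Gamma_nonneg: "\<Gamma>11 \<ge> 0" "\<Gamma>12 \<ge> 0" "\<Gamma>21 \<ge> 0" "\<Gamma>22 \<ge> 0"
    and c_eq: "c = 4 * L\<^sub>g\<^sup>2 / (\<mu>\<^sub>f * \<mu>\<^sub>g)"
    and B1_eq: "B1 = L\<^sub>f\<^sup>2 + 4 * L\<^sub>l\<^sup>2 * L\<^sub>g\<^sup>2 + 2 * L\<^sub>f * L\<^sub>l * L\<^sub>g + 1 / c * L\<^sub>g\<^sup>2 * (L\<^sub>l + 2)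
      + 4 * c * L\<^sub>l\<^sup>2 * L\<^sub>g\<^sup>2 * (L\<^sub>l + 1)\<^sup>2 + L\<^sub>g\<^sup>2 * (2 * L\<^sub>l\<^sup>2 + L\<^sub>l + 3)"
    and B2_eq: "B2 = 2 / \<mu>\<^sub>g * L\<^sub>f\<^sup>2 * L\<^sub>l\<^sup>2 * L\<^sub>g\<^sup>2 * (L\<^sub>l + 1)\<^sup>2"
    and D1_eq: "\<And>u. u > 0 \<Longrightarrow> D1 u = - (1 / 2) * \<mu>\<^sub>g
      + c * (2 / \<mu>\<^sub>f) * L\<^sub>l\<^sup>2 * (1 / u\<^sup>2) * (\<Gamma>21 * (1 / c) * u + \<Gamma>22)"
    and D2_eq: "\<And>u. u > 0 \<Longrightarrow> D2 u = B1 * u\<^sup>2 + 2 * c * u * (\<Gamma>11 * (1 / c) * u + \<Gamma>12)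
      + (2 * c * L\<^sub>l\<^sup>2 * (1 / u) + 1) * (\<Gamma>21 * (1 / c) * u + \<Gamma>22)"
    and D3_eq: "\<And>u. u > 0 \<Longrightarrow> D3 u = B2 * u\<^sup>2
      + c * (2 / \<mu>\<^sub>f) * L\<^sub>f\<^sup>2 * L\<^sub>l\<^sup>2 * (\<Gamma>21 * (1 / c) * u + \<Gamma>22)"
    and omega_ge: "\<omega> \<ge> Max {4 / \<mu>\<^sub>f * (2 * L\<^sub>l * L\<^sub>g + 2 / \<mu>\<^sub>g * L\<^sub>l\<^sup>2 * L\<^sub>g\<^sup>2 * (L\<^sub>l + 1)\<^sup>2),
      2 * c, \<mu>\<^sub>g / \<mu>\<^sub>f, 1}"
    and D1_le: "D1 \<omega> \<le> - (1 / 4) * \<mu>\<^sub>g"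
  shows "(\<exists>\<beta>>0. \<exists>\<epsilon>>0.
        exp (- \<epsilon>) = 1 + D1 \<omega> * \<beta> + D2 \<omega> * \<beta>^2 + D3 \<omega> * \<beta>^3 \<and>
        1 + D1 \<omega> * \<beta> + D2 \<omega> * \<beta>^2 + D3 \<omega> * \<beta>^3 < 1) \<and>
    (\<forall>\<beta>>0. \<forall>\<epsilon>>0.
        exp (- \<epsilon>) = 1 + D1 \<omega> * \<beta> + D2 \<omega> * \<beta>^2 + D3 \<omega> * \<beta>^3 \<and>
        1 + D1 \<omega> * \<beta> + D2 \<omega> * \<beta>^2 + D3 \<omega> * \<beta>^3 < 1 \<longrightarrow>
        (\<forall>(M :: 'w measure) x0 y0 \<xi> \<psi> x y.
          two_time_scale_process M f g lam ystar \<Gamma>11 \<Gamma>12 \<Gamma>21 \<Gamma>22 (\<omega> * \<beta>) \<beta> x0 y0 \<xi> \<psi> x y \<longrightarrow>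
          (\<forall>k. integrable M (\<lambda>w. lyapunov lam ystar c (\<omega> * \<beta>) \<beta> (x k w) (y k w)) \<and>
               (\<integral>w. lyapunov lam ystar c (\<omega> * \<beta>) \<beta> (x k w) (y k w) \<partial>M)
                 \<le> exp (- \<epsilon> * real k) * lyapunov lam ystar c (\<omega> * \<beta>) \<beta> x0 y0)))"
proof -
  have "xstar = lam ystar" using lam_unique[OF root(1)] .
  hence g_star: "g (lam ystar) ystar = 0" using root(2) by simp
  interpret coupled_maps f g lam ystar L\<^sub>f L\<^sub>g L\<^sub>l \<mu>\<^sub>f \<mu>\<^sub>g
    by unfold_locales (fact lam_root g_star lam_lipschitz f_lipschitz g_lipschitz f_monotone
        g_monotone mu_f_pos mu_g_pos)+
  interpret separated_time_scales f g lam ystar L\<^sub>f L\<^sub>g L\<^sub>l \<mu>\<^sub>f \<mu>\<^sub>g c \<omega>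
    using omega_ge by unfold_locales (auto simp: c_eq)
  have w: "\<omega> > 0" using omega_1 by simp
  let ?q = "\<lambda>\<beta>. 1 + D1 \<omega> * \<beta> + D2 \<omega> * \<beta>^2 + D3 \<omega> * \<beta>^3"
  have rates: "rate_quadratic = B1" "rate_cubic = B2"
    unfolding rate_quadratic_def rate_cubic_def B1_eq B2_eq by simp_all
  have rate: "drift \<beta> + 2 * c * \<omega> * \<beta>\<^sup>2 * (\<Gamma>11 * (1 / c) * \<omega> + \<Gamma>12)
      + psi_weight \<beta> * (\<Gamma>21 * (1 / c) * \<omega> + \<Gamma>22) = ?q \<beta>" for \<beta>
    unfolding drift_def psi_weight_def rates D1_eq[OF w] D2_eq[OF w] D3_eq[OF w]
    by (simp only: distrib_right distrib_left mult.assoc) (simp add: algebra_simps)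
  have G: "\<Gamma>11 * (1 / c) * \<omega> + \<Gamma>12 \<ge> 0" "\<Gamma>21 * (1 / c) * \<omega> + \<Gamma>22 \<ge> 0"
    using Gamma_nonneg c_pos w by auto
  have D: "D1 \<omega> < 0" "D2 \<omega> \<ge> 0" "D3 \<omega> \<ge> 0"
    using D1_le mu_pos nu_pos G c_pos w rate_quadratic_nonneg rate_cubic_nonneg
    unfolding D2_eq[OF w] D3_eq[OF w] rates by (auto intro!: add_nonneg_nonneg mult_nonneg_nonneg)
  have "\<exists>\<beta>>0. \<exists>\<epsilon>>0. exp (- \<epsilon>) = ?q \<beta> \<and> ?q \<beta> < 1"
  proof -
    obtain \<beta> where \<beta>: "\<beta> > 0" "0 < ?q \<beta>" "?q \<beta> < 1" using cubic_below_one[OF D] by blast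
    hence "- ln (?q \<beta>) > 0" "exp (- (- ln (?q \<beta>))) = ?q \<beta>" by (simp_all only: minus_minus exp_ln) simp
    thus ?thesis using \<beta> by blast
  qed
  moreover have "integrable M (\<lambda>w. lyapunov lam ystar c (\<omega> * \<beta>) \<beta> (x k w) (y k w)) \<and>
      (\<integral>w. lyapunov lam ystar c (\<omega> * \<beta>) \<beta> (x k w) (y k w) \<partial>M)
        \<le> exp (- \<epsilon> * real k) * lyapunov lam ystar c (\<omega> * \<beta>) \<beta> x0 y0"
    if "\<beta> > 0" "exp (- \<epsilon>) = ?q \<beta>"
      "two_time_scale_process M f g lam ystar \<Gamma>11 \<Gamma>12 \<Gamma>21 \<Gamma>22 (\<omega> * \<beta>) \<beta> x0 y0 \<xi> \<psi> x y"
    for \<beta> \<epsilon> k x0 y0 \<xi> \<psi> x y and M :: "'w measure"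
  proof -
    have "drift \<beta> + 2 * c * \<omega> * \<beta>\<^sup>2 * (\<Gamma>11 * (1 / c) * \<omega> + \<Gamma>12)
        + psi_weight \<beta> * (\<Gamma>21 * (1 / c) * \<omega> + \<Gamma>22) = exp (- \<epsilon>)"
      by (simp only: rate that(2))
    moreover have "exp (- \<epsilon> * real k) = exp (- \<epsilon>) ^ k" by (rule exp_of_nat2_mult)
    ultimately show ?thesis
      using lyapunov_decay[OF that(1) Gamma_nonneg that(3) _ exp_ge_zero, of "- \<epsilon>" k] by metis
  qed
  ultimately show ?thesis by blast
qed

end
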